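(* Let $\Sigma$ be the compact genus-three hyperelliptic Riemann surface of $y^2=\omega^8-14\omega^4+1$, let $\lambda\in\mathbb{C}$, and let $f=2/y$ or, more generally, $f=e^{i\theta}/y$ with $\theta\in[0,\pi/2]$. Put $$\Phi_1=\tfrac12 f\,(1-(1+\lambda^2)\omega^2)\,d\omega,\quad \Phi_2=\tfrac i2 f\,(1+(1+\lambda^2)\omega^2)\,d\omega,\quad \Phi_3=f\omega\,d\omega,\quad \Phi_4=\lambda f\omega\,d\omega,$$ holomorphic $1$-forms on $\Sigma$, and let $\mathcal{P}:H_1(\Sigma;\mathbb{Z})\to\mathbb{R}^4$, $\mathcal{P}([\gamma])=\Re\int_\gamma(\Phi_1,\Phi_2,\Phi_3,\Phi_4)$. Let $\sigma:\Sigma\to\Sigma$, $\sigma(\omega,y)=(i\omega,y)$, and let $R\in O(4)$ be given by $$R(x_1,x_2,x_3,x_4)=(x_2,-x_1,-x_3,-x_4).$$ Let $\Lambda\subset\mathbb{R}^4$ be a rank-$4$ lattice with $R\Lambda=\Lambda$. Let $\Gamma\subset H_1(\Sigma;\mathbb{Z})$ be a $\sigma_*$-stable generating set of $H_1(\Sigma;\mathbb{Z})$, and let $S\subset\Gamma$ consist of one representative from each $\sigma_*$-orbit in $\Gamma$. Then the torus-periodicity condition $$\mathcal{P}\bigl(H_1(\Sigma;\mathbb{Z})\bigr)\subset\Lambda$$ holds if and only if $\mathcal{P}([\gamma])\in\Lambda$ for every $[\gamma]\in S$.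
   Context: $\Sigma$ denotes the compactification (smooth projective model) of the affine curve $\{(\omega,y)\in\mathbb{C}^2: y^2=\omega^8-14\omega^4+1\}$; since the polynomial has degree $8$ and simple roots, $\Sigma$ has genus $3$. The automorphism $\sigma$ (of order four) is defined on the affine curve by the given formula and extends to $\Sigma$; $\sigma_*$ is the induced action on $H_1(\Sigma;\mathbb{Z})$. The Weierstrass data are $f$, $g_1=\omega$, $g_2=\lambda\omega$; the choice $f=2/y$ is the Schwarz-type seed and $f=e^{i\theta}/y$ is the codimension-two lift of the classical Schwarz associate family. The minimal immersion $X=\Re\int(\Phi_1,\dots,\Phi_4)$ is said to descend to the flat torus $\mathbb{R}^4/\Lambda$ exactly when $\mathcal{P}(H_1(\Sigma;\mathbb{Z}))\subset\Lambda$. *)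

theory Defs
  imports
    "HOL-Complex_Analysis.Complex_Analysis"
    "HOL-Homology.Homology"
    "HOL-Combinatorics.Orbits"
begin

section \<open>Differentials and their integrals on a one-dimensional complex manifold\<close>

text \<open>
  A one-dimensional complex manifold is given by a topology \<open>X\<close> and an atlas \<open>A\<close>.  A chart is a pair
  of its domain and its coordinate function.  A holomorphic 1-form is the family of its coefficients
  in the charts: in a chart \<open>(U, \<phi>)\<close> with coordinate \<open>z\<close> the form is \<open>\<alpha> (U, \<phi>) z dz\<close>.
\<close>

type_synonym 'a chart = "'a set \<times> ('a \<Rightarrow> complex)"
type_synonym 'a one_form = "'a chart \<Rightarrow> complex \<Rightarrow> complex"

definition coordinate_chart :: "'a topology \<Rightarrow> 'a set \<Rightarrow> ('a \<Rightarrow> complex) \<Rightarrow> bool" where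
  "coordinate_chart X U \<phi> \<longleftrightarrow>
     openin X U \<and> open (\<phi> ` U) \<and>
     homeomorphic_map (subtopology X U) (top_of_set (\<phi> ` U)) \<phi>"

text \<open>
  The differential \<open>h dg\<close> for meromorphic \<open>h\<close> and \<open>g\<close>.  Meromorphic functions are represented by total
  functions whose values at the poles are irrelevant: \<open>remove_sings\<close> takes the limit over the
  punctured neighbourhood, so the coefficient is the holomorphic extension wherever the singularity
  of \<open>h dg\<close> is removable (e.g. \<open>dw / y\<close> at the zeros of \<open>y\<close> and at infinity).
\<close>

definition differential :: "('a \<Rightarrow> complex) \<Rightarrow> ('a \<Rightarrow> complex) \<Rightarrow> 'a one_form" where
  "differential h g = (\<lambda>(U, \<phi>). remove_sings
     (\<lambda>z. h (inv_into U \<phi> z) * deriv (\<lambda>\<zeta>. g (inv_into U \<phi> \<zeta>)) z))"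

text \<open>\<open>F\<close> is holomorphic on the open set \<open>V\<close> with \<open>dF = \<alpha>\<close>.\<close>

definition primitive_on ::
  "'a topology \<Rightarrow> 'a chart set \<Rightarrow> 'a one_form \<Rightarrow> 'a set \<Rightarrow> ('a \<Rightarrow> complex) \<Rightarrow> bool" where
  "primitive_on X A \<alpha> V F \<longleftrightarrow>
     openin X V \<and>
     (\<forall>(U, \<phi>) \<in> A. \<forall>q \<in> U \<inter> V.
        ((\<lambda>z. F (inv_into U \<phi> z)) has_field_derivative \<alpha> (U, \<phi>) (\<phi> q)) (at (\<phi> q)))"

text \<open>
  Singular simplices are merely continuous, so a 1-form is integrated along a continuous path
  \<open>c : [0,1] \<rightarrow> X\<close> through a primitive along the path: a function \<open>h\<close> on \<open>[0,1]\<close> that is locally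
  of the form \<open>F \<circ> c\<close> for local primitives \<open>F\<close>.  Then \<open>\<integral>\<^sub>c \<alpha> = h 1 - h 0\<close>, because two such functions
  differ by a constant; for piecewise smooth \<open>c\<close> this is the integral of the pullback of \<open>\<alpha>\<close>.
\<close>

definition primitive_along ::
  "'a topology \<Rightarrow> 'a chart set \<Rightarrow> 'a one_form \<Rightarrow> (real \<Rightarrow> 'a) \<Rightarrow> (real \<Rightarrow> complex) \<Rightarrow> bool" where
  "primitive_along X A \<alpha> c h \<longleftrightarrow>
     (\<forall>t \<in> {0..1}. \<exists>V F \<delta>. primitive_on X A \<alpha> V F \<and> \<delta> > 0 \<and>
        (\<forall>s \<in> {0..1}. \<bar>s - t\<bar> < \<delta> \<longrightarrow> c s \<in> V \<and> h s = F (c s)))"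

definition path_integral ::
  "'a topology \<Rightarrow> 'a chart set \<Rightarrow> 'a one_form \<Rightarrow> (real \<Rightarrow> 'a) \<Rightarrow> complex" where
  "path_integral X A \<alpha> c = (THE I. \<exists>h. primitive_along X A \<alpha> c h \<and> I = h 1 - h 0)"

text \<open>
  A singular 1-simplex is a path from vertex 0 to vertex 1 of the standard simplex, in barycentric
  coordinates \<open>(1 - t, t)\<close>.
\<close>

definition simplex_integral ::
  "'a topology \<Rightarrow> 'a chart set \<Rightarrow> 'a one_form \<Rightarrow> ((nat \<Rightarrow> real) \<Rightarrow> 'a) \<Rightarrow> complex" where
  "simplex_integral X A \<alpha> s =
     path_integral X A \<alpha> (\<lambda>t. s (\<lambda>i. if i = 0 then 1 - t else if i = 1 then t else 0))"

definition chain_integral ::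
  "'a topology \<Rightarrow> 'a chart set \<Rightarrow> 'a one_form \<Rightarrow> 'a chain \<Rightarrow> complex" where
  "chain_integral X A \<alpha> c =
     (\<Sum>s \<in> Poly_Mapping.keys c. of_int (Poly_Mapping.lookup c s) * simplex_integral X A \<alpha> s)"

text \<open>
  An element of the homology group is a coset of cycles, and the integral over it is the common
  value of the integrals over its representatives.
\<close>

definition homology_integral ::
  "'a topology \<Rightarrow> 'a chart set \<Rightarrow> 'a one_form \<Rightarrow> 'a chain set \<Rightarrow> complex" where
  "homology_integral X A \<alpha> C = (THE I. \<forall>c \<in> C. chain_integral X A \<alpha> c = I)"


section \<open>The hyperelliptic curve\<close>

text \<open>
  The smooth projective model of \<open>y\<^sup>2 = w^8 - 14 w^4 + 1\<close> is glued from the affine curve and the affine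
  curve \<open>v\<^sup>2 = 1 - 14 u^4 + u^8\<close> along \<open>u = 1/w\<close>, \<open>v = y/w^4\<close>.  \<open>Aff w y\<close> is a point of the first one,
  \<open>Infty v\<close> the point \<open>(0, v)\<close> of the second one.
\<close>

datatype curve_point = Aff complex complex | Infty complex

definition affine_curve :: "(complex \<times> complex) set" where
  "affine_curve = {(w, y). y\<^sup>2 = w ^ 8 - 14 * w ^ 4 + 1}"

definition affine_curve_inf :: "(complex \<times> complex) set" where
  "affine_curve_inf = {(u, v). v\<^sup>2 = 1 - 14 * u ^ 4 + u ^ 8}"

definition glue :: "complex \<times> complex \<Rightarrow> curve_point" where
  "glue = (\<lambda>(w, y). Aff w y)"

definition glue_inf :: "complex \<times> complex \<Rightarrow> curve_point" where
  "glue_inf = (\<lambda>(u, v). if u = 0 then Infty v else Aff (1 / u) (v / u ^ 4))"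

definition curve_points :: "curve_point set" where
  "curve_points = glue ` affine_curve \<union> glue_inf ` affine_curve_inf"

definition curve_open :: "curve_point set \<Rightarrow> bool" where
  "curve_open W \<longleftrightarrow> W \<subseteq> curve_points \<and>
     openin (top_of_set affine_curve) (affine_curve \<inter> glue -` W) \<and>
     openin (top_of_set affine_curve_inf) (affine_curve_inf \<inter> glue_inf -` W)"

definition Sigma_curve :: "curve_point topology" where
  "Sigma_curve = topology curve_open"

lemma istopology_curve_open: "istopology curve_open"
  unfolding istopology_def
proof (intro conjI allI impI)
  fix S T assume ST: "curve_open S" "curve_open T"
  have eq: "Y \<inter> g -` (S \<inter> T) = (Y \<inter> g -` S) \<inter> (Y \<inter> g -` T)"
    for Y and g :: "complex \<times> complex \<Rightarrow> curve_point"
    by auto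
  show "curve_open (S \<inter> T)"
    using ST unfolding curve_open_def eq by (blast intro: openin_Int)
next
  fix K assume K: "\<forall>W\<in>K. curve_open W"
  have eq: "Y \<inter> g -` \<Union>K = \<Union>((\<lambda>W. Y \<inter> g -` W) ` K)"
    for Y and g :: "complex \<times> complex \<Rightarrow> curve_point"
    by auto
  show "curve_open (\<Union>K)"
    using K unfolding curve_open_def eq by (intro conjI openin_Union) blast+
qed

lemma openin_Sigma_curve: "openin Sigma_curve W \<longleftrightarrow> curve_open W"
  by (simp add: Sigma_curve_def topology_inverse' istopology_curve_open)

lemma topspace_Sigma_curve: "topspace Sigma_curve = curve_points"
proof -
  have "affine_curve \<inter> glue -` curve_points = affine_curve"
    and "affine_curve_inf \<inter> glue_inf -` curve_points = affine_curve_inf"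
    by (auto simp: curve_points_def)
  then have "openin Sigma_curve curve_points"
    by (simp add: openin_Sigma_curve curve_open_def)
  then show ?thesis
    by (metis curve_open_def openin_Sigma_curve openin_subset openin_topspace subset_antisym)
qed

text \<open>
  The coordinate functions.  Those called \<open>w_coord\<close> and \<open>y_coord\<close> have poles at the two points at infinity,
  and \<open>u_coord = 1 / w\<close> has poles at the points with \<open>w = 0\<close>; the values there are irrelevant.
\<close>

fun w_coord :: "curve_point \<Rightarrow> complex" where
  "w_coord (Aff w y) = w"
| "w_coord (Infty v) = 0"

fun y_coord :: "curve_point \<Rightarrow> complex" where
  "y_coord (Aff w y) = y"
| "y_coord (Infty v) = 0"

fun u_coord :: "curve_point \<Rightarrow> complex" where
  "u_coord (Aff w y) = 1 / w"
| "u_coord (Infty v) = 0"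

text \<open>
  Local coordinates, by the implicit function theorem: \<open>w\<close> away from the branch points (\<open>y \<noteq> 0\<close>), \<open>y\<close>
  where \<open>\<partial>(w^8 - 14 w^4 + 1)/\<partial>w \<noteq> 0\<close> (in particular at the branch points), and \<open>u\<close> at infinity.
\<close>

definition Sigma_atlas :: "curve_point chart set" where
  "Sigma_atlas =
     {(U, w_coord) | U. coordinate_chart Sigma_curve U w_coord \<and>
        U \<subseteq> {Aff w y | w y. y \<noteq> 0}} \<union>
     {(U, y_coord) | U. coordinate_chart Sigma_curve U y_coord \<and>
        U \<subseteq> {Aff w y | w y. 8 * w ^ 7 - 56 * w ^ 3 \<noteq> 0}} \<union>
     {(U, u_coord) | U. coordinate_chart Sigma_curve U u_coord \<and>
        U \<subseteq> {Aff w y | w y. w \<noteq> 0 \<and> y \<noteq> 0} \<union> range Infty}"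

abbreviation H1 :: "curve_point chain set monoid" where
  "H1 \<equiv> homology_group 1 Sigma_curve"

text \<open>
  The extension of \<open>(w, y) \<mapsto> (\<i> w, y)\<close> fixes the points at infinity, since \<open>v = y/w^4\<close> is invariant.
\<close>

fun sigma :: "curve_point \<Rightarrow> curve_point" where
  "sigma (Aff w y) = Aff (\<i> * w) y"
| "sigma (Infty v) = Infty v"

definition sigma_star :: "curve_point chain set \<Rightarrow> curve_point chain set" where
  "sigma_star = hom_induced 1 Sigma_curve {} Sigma_curve {} sigma"

text \<open>
  The library's \<open>hom_induced\<close> is trivial by convention for maps that are not continuous, which the
  following fact excludes.
\<close>

lemma continuous_map_sigma: "continuous_map Sigma_curve Sigma_curve sigma"
proof -
  let ?a = "\<lambda>(w, y). (\<i> * w, y) :: complex \<times> complex"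
  let ?b = "\<lambda>(u, v). (- \<i> * u, v) :: complex \<times> complex"
  have i4: "\<i> ^ 4 = (\<i>\<^sup>2)\<^sup>2" "\<i> ^ 8 = ((\<i>\<^sup>2)\<^sup>2)\<^sup>2"
    by (simp_all only: power_mult [symmetric], simp_all)
  have i8: "(\<i> * w) ^ 4 = w ^ 4" "(\<i> * w) ^ 8 = w ^ 8" for w
    by (simp_all add: power_mult_distrib i4)
  have a: "?a ` affine_curve \<subseteq> affine_curve"
    by (auto simp: affine_curve_def i8)
  have b: "?b ` affine_curve_inf \<subseteq> affine_curve_inf"
    by (auto simp: affine_curve_inf_def i8)
  have ca: "continuous_map (top_of_set affine_curve) (top_of_set affine_curve) ?a"
    using a by (auto simp: case_prod_unfold intro!: continuous_intros)
  have cb: "continuous_map (top_of_set affine_curve_inf) (top_of_set affine_curve_inf) ?b"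
    using b by (auto simp: case_prod_unfold intro!: continuous_intros)
  have ga: "sigma (glue p) = glue (?a p)" for p
    by (cases p) (simp add: glue_def)
  have gb: "sigma (glue_inf p) = glue_inf (?b p)" for p
    by (cases p) (auto simp: glue_inf_def i8 field_simps)
  have im: "sigma q \<in> curve_points" if "q \<in> curve_points" for q
    using that a b ga gb unfolding curve_points_def by blast
  have "curve_open {q \<in> curve_points. sigma q \<in> W}" if W: "curve_open W" for W
  proof -
    have "affine_curve \<inter> glue -` {q \<in> curve_points. sigma q \<in> W} =
          {p \<in> topspace (top_of_set affine_curve). ?a p \<in> affine_curve \<inter> glue -` W}"
      using a ga by (auto simp: curve_points_def simp del: sigma.simps)
    moreover have "affine_curve_inf \<inter> glue_inf -` {q \<in> curve_points. sigma q \<in> W} =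
          {p \<in> topspace (top_of_set affine_curve_inf). ?b p \<in> affine_curve_inf \<inter> glue_inf -` W}"
      using b gb by (auto simp: curve_points_def simp del: sigma.simps)
    ultimately show ?thesis
      using W ca cb unfolding curve_open_def continuous_map_def by auto
  qed
  then show ?thesis
    using im by (auto simp: continuous_map_def topspace_Sigma_curve openin_Sigma_curve)
qed


section \<open>Weierstrass data, the period map and lattices\<close>

definition Phi1 :: "complex \<Rightarrow> (curve_point \<Rightarrow> complex) \<Rightarrow> curve_point one_form" where
  "Phi1 lam f =
     differential (\<lambda>q. 1 / 2 * f q * (1 - (1 + lam\<^sup>2) * (w_coord q)\<^sup>2)) w_coord"

definition Phi2 :: "complex \<Rightarrow> (curve_point \<Rightarrow> complex) \<Rightarrow> curve_point one_form" where
  "Phi2 lam f =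
     differential (\<lambda>q. \<i> / 2 * f q * (1 + (1 + lam\<^sup>2) * (w_coord q)\<^sup>2)) w_coord"

definition Phi3 :: "complex \<Rightarrow> (curve_point \<Rightarrow> complex) \<Rightarrow> curve_point one_form" where
  "Phi3 lam f = differential (\<lambda>q. f q * w_coord q) w_coord"

definition Phi4 :: "complex \<Rightarrow> (curve_point \<Rightarrow> complex) \<Rightarrow> curve_point one_form" where
  "Phi4 lam f = differential (\<lambda>q. lam * f q * w_coord q) w_coord"

definition period_map ::
  "complex \<Rightarrow> (curve_point \<Rightarrow> complex) \<Rightarrow> curve_point chain set \<Rightarrow> real ^ 4" where
  "period_map lam f C = vector
     [Re (homology_integral Sigma_curve Sigma_atlas (Phi1 lam f) C),
      Re (homology_integral Sigma_curve Sigma_atlas (Phi2 lam f) C),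
      Re (homology_integral Sigma_curve Sigma_atlas (Phi3 lam f) C),
      Re (homology_integral Sigma_curve Sigma_atlas (Phi4 lam f) C)]"

definition R_map :: "real ^ 4 \<Rightarrow> real ^ 4" where
  "R_map x = vector [x $ 2, - (x $ 1), - (x $ 3), - (x $ 4)]"

lemma vector_4 [simp]:
  "(vector [a, b, c, d] :: 'a::zero ^ 4) $ 1 = a"
  "(vector [a, b, c, d] :: 'a::zero ^ 4) $ 2 = b"
  "(vector [a, b, c, d] :: 'a::zero ^ 4) $ 3 = c"
  "(vector [a, b, c, d] :: 'a::zero ^ 4) $ 4 = d"
  by (simp_all add: vector_def)

definition rank4_lattice :: "(real ^ 4) set \<Rightarrow> bool" where
  "rank4_lattice L \<longleftrightarrow> (\<exists>B. independent B \<and> card B = 4 \<and>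
     L = {\<Sum>b\<in>B. of_int (n b) *\<^sub>R b | n :: real ^ 4 \<Rightarrow> int. True})"

end

theory Submission
  imports Defs
begin

text \<open>
  A primitive of a locally exact form along a continuous map from a square is glued from local
  primitives by bisection. The square maps onto the 2-simplex by collapsing one side, so the integral
  over the boundary of a singular 2-simplex vanishes, and integration is additive on homology.
  On the curve the forms \<open>(a + b w + c w\<^sup>2) dw / y\<close> have local primitives also at the branch points and
  at infinity, and \<open>\<sigma>\<close> pulls them back by \<open>(a, b, c) \<mapsto> (\<i> a, - b, - \<i> c)\<close>. Hence
  \<open>\<P>(\<sigma>\<^sub>* \<gamma>) = R \<P>(\<gamma>)\<close>; since \<open>R\<close> permutes \<open>\<Lambda>\<close>, the condition propagates along orbits.
\<close>

section \<open>Integrals of locally exact forms\<close>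

text \<open>All integrals here are definite descriptions over merely continuous simplices, so
  existence and uniqueness must be established before anything can be computed. A primitive along a
  map, unlike an integrated pullback, makes sense for continuous maps and restricts to the sides of
  a square; hence the argument works with primitives throughout.

  A second obstacle is that the atlas contains every chart with one of the three coordinate
  functions, while the coefficient of a form is a limit at branch points and at infinity. A
  primitive built in one chart has to be verified in all others. This goes through relations between
  the coefficient and the derivatives of \<open>w\<close> and \<open>y\<close> that hold in each
  chart and can be cancelled at every affine point.

  The forms dw/y, w dw/y and w^2 dw/y span the holomorphic differentials of the genus-three curve
  and are eigenforms of the pullback by \<open>sigma\<close>, with eigenvalues \<i>, -1 and -\<i>.
  Treating their span as a whole handles all four \<open>Phi\<close> forms and every seed at
  once.\<close>

definition primitive_over ::
  "'a topology \<Rightarrow> 'a chart set \<Rightarrow> 'a one_form \<Rightarrow> 'b::topological_space set \<Rightarrow>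
     ('b \<Rightarrow> 'a) \<Rightarrow> ('b \<Rightarrow> complex) \<Rightarrow> bool" where
  "primitive_over X A \<alpha> D c h \<longleftrightarrow>
     (\<forall>t\<in>D. \<exists>V F. primitive_on X A \<alpha> V F \<and>
        (\<forall>\<^sub>F s in nhds t. s \<in> D \<longrightarrow> c s \<in> V \<and> h s = F (c s)))"

text \<open>The neighbourhood filter replaces the radius, so that one notion serves the interval,
  the square and all their subsets.\<close>

lemma primitive_along_iff_primitive_over:
  "primitive_along X A \<alpha> c h \<longleftrightarrow> primitive_over X A \<alpha> {0..1} c h"
proof -
  have "(\<exists>\<delta>. primitive_on X A \<alpha> V F \<and> \<delta> > 0 \<and>
        (\<forall>s \<in> {0..1}. \<bar>s - t\<bar> < \<delta> \<longrightarrow> c s \<in> V \<and> h s = F (c s))) \<longleftrightarrow>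
      primitive_on X A \<alpha> V F \<and> (\<forall>\<^sub>F s in nhds t. s \<in> {0..1} \<longrightarrow> c s \<in> V \<and> h s = F (c s))"
    for V F t
    unfolding eventually_nhds_metric dist_real_def by blast
  then show ?thesis
    unfolding primitive_along_def primitive_over_def by presburger
qed

lemma primitive_onI:
  assumes "openin X V"
    and "\<And>U \<phi> q. (U, \<phi>) \<in> A \<Longrightarrow> q \<in> U \<Longrightarrow> q \<in> V \<Longrightarrow>
      ((\<lambda>z. F (inv_into U \<phi> z)) has_field_derivative \<alpha> (U, \<phi>) (\<phi> q)) (at (\<phi> q))"
  shows "primitive_on X A \<alpha> V F"
  using assms unfolding primitive_on_def by blast

lemma primitive_onD:
  assumes "primitive_on X A \<alpha> V F"
  shows primitive_on_openin: "openin X V"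
    and primitive_on_deriv: "(U, \<phi>) \<in> A \<Longrightarrow> q \<in> U \<Longrightarrow> q \<in> V \<Longrightarrow>
      ((\<lambda>z. F (inv_into U \<phi> z)) has_field_derivative \<alpha> (U, \<phi>) (\<phi> q)) (at (\<phi> q))"
  using assms unfolding primitive_on_def by blast+

lemma primitive_on_add_const:
  assumes "primitive_on X A \<alpha> V F"
  shows "primitive_on X A \<alpha> V (\<lambda>q. F q + k)"
proof (rule primitive_onI)
  fix U \<phi> q assume "(U, \<phi>) \<in> A" "q \<in> U" "q \<in> V"
  then have "((\<lambda>z. F (inv_into U \<phi> z)) has_field_derivative \<alpha> (U, \<phi>) (\<phi> q)) (at (\<phi> q))"
    by (rule primitive_on_deriv[OF assms])
  from DERIV_add[OF this DERIV_const[of k]]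
  show "((\<lambda>z. F (inv_into U \<phi> z) + k) has_field_derivative \<alpha> (U, \<phi>) (\<phi> q)) (at (\<phi> q))"
    by simp
qed (rule primitive_on_openin[OF assms])

text \<open>Local primitives live on \<open>X\<close>, so reparametrisation asks only for continuity
  of \<open>g\<close>. Restriction to sides of the square and to subsets is a special case.\<close>

lemma primitive_over_compose:
  assumes h: "primitive_over X A \<alpha> D c h" and g: "continuous_on D' g" "g ` D' \<subseteq> D"
  shows "primitive_over X A \<alpha> D' (c \<circ> g) (h \<circ> g)"
  unfolding primitive_over_def
proof
  fix t assume t: "t \<in> D'"
  then have "g t \<in> D" using g(2) by blast
  then obtain V F where VF: "primitive_on X A \<alpha> V F"
      and ev: "\<forall>\<^sub>F s in nhds (g t). s \<in> D \<longrightarrow> c s \<in> V \<and> h s = F (c s)"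
    using h unfolding primitive_over_def by blast
  obtain N where N: "open N" "g t \<in> N" "\<forall>s\<in>N. s \<in> D \<longrightarrow> c s \<in> V \<and> h s = F (c s)"
    using ev by (auto simp: eventually_nhds)
  obtain M where M: "open M" "t \<in> M" "\<forall>s\<in>D'. s \<in> M \<longrightarrow> g s \<in> N"
    using g(1) t N(1,2) unfolding continuous_on_topological by blast
  have "\<forall>\<^sub>F s in nhds t. s \<in> D' \<longrightarrow> (c \<circ> g) s \<in> V \<and> (h \<circ> g) s = F ((c \<circ> g) s)"
    unfolding eventually_nhds using M N(3) g(2) by (intro exI[of _ M]) auto
  with VF show "\<exists>V F. primitive_on X A \<alpha> V F \<and>
      (\<forall>\<^sub>F s in nhds t. s \<in> D' \<longrightarrow> (c \<circ> g) s \<in> V \<and> (h \<circ> g) s = F ((c \<circ> g) s))"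
    by blast
qed

lemma primitive_over_subset:
  assumes "primitive_over X A \<alpha> D c h" and "D' \<subseteq> D"
  shows "primitive_over X A \<alpha> D' c h"
  using primitive_over_compose[OF assms(1), of D' "\<lambda>x. x"] assms(2) by (simp add: comp_def)

lemma primitive_over_single_primitive:
  assumes "primitive_on X A \<alpha> V F" and "c ` D \<subseteq> V"
  shows "primitive_over X A \<alpha> D c (F \<circ> c)"
  unfolding primitive_over_def using assms by (auto intro!: exI always_eventually)

text \<open>The hypothesis \<open>pull\<close> encodes that \<open>\<beta>\<close> is
  \<open>k\<close> times the pullback of \<open>\<alpha>\<close> by \<open>f\<close>. It is phrased
  through primitives, so that no pullback has to be written out in charts.\<close>

lemma primitive_over_push:
  assumes h: "primitive_over X A \<alpha> D (f \<circ> c) h"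
    and c: "c ` D \<subseteq> topspace Y"
    and pull: "\<And>V F. primitive_on X A \<alpha> V F \<Longrightarrow>
       primitive_on Y B \<beta> {q \<in> topspace Y. f q \<in> V} (\<lambda>q. k * F (f q))"
  shows "primitive_over Y B \<beta> D c (\<lambda>t. k * h t)"
  unfolding primitive_over_def
proof
  fix t assume "t \<in> D"
  then obtain V F where VF: "primitive_on X A \<alpha> V F"
      and ev: "\<forall>\<^sub>F s in nhds t. s \<in> D \<longrightarrow> (f \<circ> c) s \<in> V \<and> h s = F ((f \<circ> c) s)"
    using h unfolding primitive_over_def by blast
  from ev have "\<forall>\<^sub>F s in nhds t. s \<in> D \<longrightarrow>
      c s \<in> {q \<in> topspace Y. f q \<in> V} \<and> k * h s = k * F (f (c s))"
    by eventually_elim (use c in auto)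
  then show "\<exists>V F. primitive_on Y B \<beta> V F \<and>
      (\<forall>\<^sub>F s in nhds t. s \<in> D \<longrightarrow> c s \<in> V \<and> k * h s = F (c s))"
    using pull[OF VF] by blast
qed

lemma eventually_nhds_continuous_map:
  assumes "continuous_map (top_of_set D) X c" "openin X N" "t \<in> D" "c t \<in> N"
  shows "\<forall>\<^sub>F s in nhds t. s \<in> D \<longrightarrow> c s \<in> N"
proof -
  have "openin (top_of_set D) {s \<in> D. c s \<in> N}"
    using openin_continuous_map_preimage[OF assms(1,2)] by simp
  then obtain T where "open T" "{s \<in> D. c s \<in> N} = D \<inter> T"
    by (auto simp: openin_open)
  then show ?thesis
    unfolding eventually_nhds using assms(3,4) by (intro exI[of _ T]) auto
qed

text \<open>This separates the topology of periods from the curve. \<open>covered\<close> matters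
  because \<open>primitive_on\<close> tests derivatives only in charts of \<open>A\<close>: at an
  uncovered point the test would be vacuous and primitives could differ arbitrarily.\<close>

locale locally_exact_form =
  fixes X :: "'a topology" and A :: "'a chart set" and \<alpha> :: "'a one_form"
  assumes chart: "(U, \<phi>) \<in> A \<Longrightarrow> coordinate_chart X U \<phi>"
    and covered: "p \<in> topspace X \<Longrightarrow> \<exists>(U, \<phi>) \<in> A. p \<in> U"
    and local_primitive: "p \<in> topspace X \<Longrightarrow> \<exists>V F. p \<in> V \<and> primitive_on X A \<alpha> V F"
begin

text \<open>In a chart the difference of two primitives has derivative zero. The neighbourhood is
  the part of the chart over a disc, whose convexity makes the difference constant.\<close>

lemma primitives_differ_by_const:
  assumes F: "primitive_on X A \<alpha> V F" and G: "primitive_on X A \<alpha> W G" and p: "p \<in> V" "p \<in> W"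
  obtains N where "openin X N" "p \<in> N" "N \<subseteq> V \<inter> W" "\<And>q. q \<in> N \<Longrightarrow> F q - G q = F p - G p"
proof -
  have op: "openin X V" "openin X W"
    using F G by (auto simp: primitive_on_def)
  then have "p \<in> topspace X"
    using p openin_subset by blast
  then obtain U \<phi> where U: "(U, \<phi>) \<in> A" "p \<in> U"
    using covered by blast
  let ?\<psi> = "inv_into U \<phi>"
  have UX: "openin X U" "open (\<phi> ` U)" and hom: "homeomorphic_map (subtopology X U) (top_of_set (\<phi> ` U)) \<phi>"
    using chart[OF U(1)] by (auto simp: coordinate_chart_def)
  have top: "topspace (subtopology X U) = U"
    using UX(1) openin_subset by auto
  have inj: "inj_on \<phi> U"
    using homeomorphic_imp_injective_map[OF hom] top by simp
  let ?W = "U \<inter> V \<inter> W"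
  have W: "openin X ?W"
    using UX op by blast
  then have "openin (subtopology X U) ?W"
    using openin_subset_topspace_eq UX(1) openin_open_subtopology by blast
  then have "openin (top_of_set (\<phi> ` U)) (\<phi> ` ?W)"
    using hom homeomorphic_map_openness_eq by blast
  then have oW: "open (\<phi> ` ?W)"
    using UX(2) openin_open_trans by blast
  have "\<phi> p \<in> \<phi> ` ?W"
    using U p by blast
  then obtain e where e: "e > 0" "ball (\<phi> p) e \<subseteq> \<phi> ` ?W"
    using oW open_contains_ball by blast
  define N where "N = {q \<in> ?W. \<phi> q \<in> ball (\<phi> p) e}"
  have cont: "continuous_map (subtopology X U) euclidean \<phi>"
    using homeomorphic_imp_continuous_map[OF hom] continuous_map_in_subtopology by blast
  have "openin (subtopology X U) {q \<in> U. \<phi> q \<in> ball (\<phi> p) e}"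
    using openin_continuous_map_preimage[OF cont, of "ball (\<phi> p) e"] by (simp only: top open_openin[symmetric] open_ball)
  then have "openin X {q \<in> U. \<phi> q \<in> ball (\<phi> p) e}"
    using openin_open_subtopology[OF UX(1)] by blast
  then have "openin X (?W \<inter> {q \<in> U. \<phi> q \<in> ball (\<phi> p) e})"
    using W by blast
  moreover have "?W \<inter> {q \<in> U. \<phi> q \<in> ball (\<phi> p) e} = N"
    by (auto simp: N_def)
  ultimately have 1: "openin X N" by simp
  have 2: "p \<in> N" using U p e by (auto simp: N_def)
  have der: "((\<lambda>z. F (?\<psi> z) - G (?\<psi> z)) has_field_derivative 0) (at z within ball (\<phi> p) e)"
    if z: "z \<in> ball (\<phi> p) e" for z
  proof -
    obtain q where q: "q \<in> ?W" "z = \<phi> q"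
      using z e(2) by blast
    have "((\<lambda>z. F (?\<psi> z)) has_field_derivative \<alpha> (U, \<phi>) z) (at z)"
         "((\<lambda>z. G (?\<psi> z)) has_field_derivative \<alpha> (U, \<phi>) z) (at z)"
      unfolding q(2) using q(1) by (auto intro: primitive_on_deriv[OF F U(1)] primitive_on_deriv[OF G U(1)])
    from DERIV_diff[OF this] show ?thesis
      by (simp add: has_field_derivative_at_within)
  qed
  have "\<exists>k. \<forall>z\<in>ball (\<phi> p) e. F (?\<psi> z) - G (?\<psi> z) = k"
    by (rule has_field_derivative_zero_constant[OF convex_ball der])
  then obtain k where k: "\<And>z. z \<in> ball (\<phi> p) e \<Longrightarrow> F (?\<psi> z) - G (?\<psi> z) = k"
    by blast
  have 3: "F q - G q = k" if "q \<in> N" for q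
    using k[of "\<phi> q"] that inj by (auto simp: N_def inv_into_f_f)
  show thesis
  proof (rule that[of N])
    show "N \<subseteq> V \<inter> W" by (auto simp: N_def)
  qed (use 1 2 3 in auto)
qed

text \<open>The difference of the two primitives is locally constant along \<open>c\<close>, hence
  constant on the connected set \<open>D\<close>. This makes path integrals independent of the
  chosen primitive.\<close>

lemma primitive_over_unique:
  assumes h: "primitive_over X A \<alpha> D c h" "primitive_over X A \<alpha> D c h'"
    and c: "continuous_map (top_of_set D) X c" and D: "connected D" "s \<in> D" "t \<in> D"
  shows "h s - h' s = h t - h' t"
proof (rule connected_local_const[OF D(1,2,3)], intro ballI)
  fix a assume a: "a \<in> D"
  obtain V F where V: "primitive_on X A \<alpha> V F" "\<forall>\<^sub>F s in nhds a. s \<in> D \<longrightarrow> c s \<in> V \<and> h s = F (c s)"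
    using h(1) a by (auto simp: primitive_over_def)
  obtain W G where W: "primitive_on X A \<alpha> W G" "\<forall>\<^sub>F s in nhds a. s \<in> D \<longrightarrow> c s \<in> W \<and> h' s = G (c s)"
    using h(2) a by (auto simp: primitive_over_def)
  have at: "c a \<in> V" "h a = F (c a)" "c a \<in> W" "h' a = G (c a)"
    using eventually_nhds_x_imp_x[OF V(2)] eventually_nhds_x_imp_x[OF W(2)] a by auto
  obtain N where N: "openin X N" "c a \<in> N" "\<And>q. q \<in> N \<Longrightarrow> F q - G q = F (c a) - G (c a)"
    using primitives_differ_by_const[OF V(1) W(1) at(1,3)] by metis
  have "\<forall>\<^sub>F s in nhds a. s \<in> D \<longrightarrow> h a - h' a = h s - h' s"
    using V(2) W(2) eventually_nhds_continuous_map[OF c N(1) a N(2)]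
    by eventually_elim (use N(3) at in auto)
  then show "\<forall>\<^sub>F b in at a within D. h a - h' a = h b - h' b"
    by (simp add: eventually_at_filter eventually_mono)
qed

text \<open>On the connected overlap the two primitives differ by a single constant
  \<open>k\<close>; adding it to the second one makes them agree there.\<close>

lemma primitive_over_glue:
  assumes h: "primitive_over X A \<alpha> D c h" "primitive_over X A \<alpha> E c h'"
    and cl: "closed D" "closed E" and con: "connected (D \<inter> E)" "D \<inter> E \<noteq> {}"
    and c: "continuous_map (top_of_set (D \<union> E)) X c"
  shows "\<exists>g. primitive_over X A \<alpha> (D \<union> E) c g"
proof -
  obtain r where r: "r \<in> D \<inter> E" using con by blast
  define k where "k = h r - h' r"
  have cDE: "continuous_map (top_of_set (D \<inter> E)) X c"
    using c continuous_map_from_subtopology_mono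
    by (metis inf_le1 le_supI1)
  have k: "h t - h' t = k" if "t \<in> D \<inter> E" for t
    unfolding k_def
    using primitive_over_unique[OF primitive_over_subset[OF h(1)] primitive_over_subset[OF h(2)] cDE con(1) that r]
    by simp
  define g where "g t = (if t \<in> D then h t else h' t + k)" for t
  have "primitive_over X A \<alpha> (D \<union> E) c g"
    unfolding primitive_over_def
  proof
    fix t assume t: "t \<in> D \<union> E"
    \<comment> \<open>Closedness gives a point outside one piece a neighbourhood missing that piece,
      so near it \<open>g\<close> is governed by the other piece alone.\<close>
    have offD: "\<forall>\<^sub>F s in nhds t. s \<notin> D" if "t \<notin> D"
      using eventually_nhds_in_open[of "- D" t] cl that by (simp add: open_Compl)
    have offE: "\<forall>\<^sub>F s in nhds t. s \<notin> E" if "t \<notin> E"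
      using eventually_nhds_in_open[of "- E" t] cl that by (simp add: open_Compl)
    consider "t \<in> D" "t \<notin> E" | "t \<in> D" "t \<in> E" | "t \<notin> D" "t \<in> E" using t by blast
    then show "\<exists>V F. primitive_on X A \<alpha> V F \<and>
        (\<forall>\<^sub>F s in nhds t. s \<in> D \<union> E \<longrightarrow> c s \<in> V \<and> g s = F (c s))"
    proof cases
      case 1
      then obtain V F where V: "primitive_on X A \<alpha> V F"
          "\<forall>\<^sub>F s in nhds t. s \<in> D \<longrightarrow> c s \<in> V \<and> h s = F (c s)"
        using h(1) by (auto simp: primitive_over_def)
      have "\<forall>\<^sub>F s in nhds t. s \<in> D \<union> E \<longrightarrow> c s \<in> V \<and> g s = F (c s)"
        using V(2) offE[OF 1(2)] by eventually_elim (auto simp: g_def)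
      with V(1) show ?thesis by blast
    next
      case 3
      then obtain V F where V: "primitive_on X A \<alpha> V F"
          "\<forall>\<^sub>F s in nhds t. s \<in> E \<longrightarrow> c s \<in> V \<and> h' s = F (c s)"
        using h(2) by (auto simp: primitive_over_def)
      have "\<forall>\<^sub>F s in nhds t. s \<in> D \<union> E \<longrightarrow> c s \<in> V \<and> g s = F (c s) + k"
        using V(2) offD[OF 3(1)] by eventually_elim (auto simp: g_def)
      with primitive_on_add_const[OF V(1), of k] show ?thesis by blast
    next
      case 2
      then obtain V F where V: "primitive_on X A \<alpha> V F"
          "\<forall>\<^sub>F s in nhds t. s \<in> D \<longrightarrow> c s \<in> V \<and> h s = F (c s)"
        using h(1) by (auto simp: primitive_over_def)
      obtain W G where W: "primitive_on X A \<alpha> W G"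
          "\<forall>\<^sub>F s in nhds t. s \<in> E \<longrightarrow> c s \<in> W \<and> h' s = G (c s)"
        using h(2) 2 by (auto simp: primitive_over_def)
      have at: "c t \<in> V" "h t = F (c t)" "c t \<in> W" "h' t = G (c t)"
        using eventually_nhds_x_imp_x[OF V(2)] eventually_nhds_x_imp_x[OF W(2)] 2 by auto
      obtain N where N: "openin X N" "c t \<in> N" "N \<subseteq> V \<inter> W"
          "\<And>q. q \<in> N \<Longrightarrow> F q - G q = F (c t) - G (c t)"
        using primitives_differ_by_const[OF V(1) W(1) at(1,3)] by metis
      \<comment> \<open>The difference \<open>F - G\<close> equals \<open>k\<close> at
        \<open>c t\<close> and stays \<open>k\<close> on \<open>N\<close>, so \<open>F\<close> also
        describes the shifted primitive over \<open>E\<close>.\<close>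
      have kt: "F (c t) - G (c t) = k" using k 2 at by force
      have "\<forall>\<^sub>F s in nhds t. s \<in> D \<union> E \<longrightarrow> c s \<in> V \<and> g s = F (c s)"
        using V(2) W(2) eventually_nhds_continuous_map[OF c N(1) t N(2)]
      proof eventually_elim
        case (elim s)
        show ?case
        proof (intro impI)
          assume s: "s \<in> D \<union> E"
          then have "c s \<in> N" using elim by blast
          then show "c s \<in> V \<and> g s = F (c s)"
            using elim s N(3) N(4)[of "c s"] kt by (auto simp: g_def algebra_simps)
        qed
      qed
      with V(1) show ?thesis by blast
    qed
  qed
  then show ?thesis by blast
qed

text \<open>Compactness enters as Bolzano's bisection, applied to widths and then to heights.
  Adjacent rectangles meet in a segment, which is connected, so gluing applies at every
  merge.\<close>

lemma primitive_over_unit_square: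
  fixes c :: "real \<times> real \<Rightarrow> 'a"
  assumes c: "continuous_map (top_of_set ({0..1} \<times> {0..1})) X c"
  shows "\<exists>h. primitive_over X A \<alpha> ({0..1} \<times> {0..1}) c h"
proof -
  let ?Q = "{0..1::real} \<times> {0..1::real}"
  define E where "E D \<longleftrightarrow> (\<exists>h. primitive_over X A \<alpha> D c h)" for D
  have glue: "E (D \<union> D')" if "E D" "E D'" "closed D" "closed D'" "connected (D \<inter> D')" "D \<inter> D' \<noteq> {}"
    "D \<union> D' \<subseteq> ?Q" for D D'
    using primitive_over_glue[OF _ _ that(3-6) continuous_map_from_subtopology_mono[OF c that(7)]] that(1,2)
    unfolding E_def by blast
  have small: "\<exists>e>0. \<forall>a b c d. 0 \<le> a \<and> a \<le> x \<and> x \<le> b \<and> b \<le> 1 \<and> b - a < e \<and>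
      0 \<le> c \<and> c \<le> y \<and> y \<le> d \<and> d \<le> 1 \<and> d - c < e \<longrightarrow> E ({a..b} \<times> {c..d})"
    if xy: "x \<in> {0..1}" "y \<in> {0..1}" for x y
  proof -
    have "c (x, y) \<in> topspace X"
      using c xy by (auto simp: continuous_map_def Pi_iff)
    then obtain V F where V: "c (x, y) \<in> V" "primitive_on X A \<alpha> V F"
      using local_primitive by blast
    then have "openin X V" by (simp add: primitive_on_def)
    then obtain e where e: "e > 0" "\<And>s. dist s (x, y) < e \<Longrightarrow> s \<in> ?Q \<Longrightarrow> c s \<in> V"
      using eventually_nhds_continuous_map[OF c _ _ V(1)] xy unfolding eventually_nhds_metric
      by auto
    \<comment> \<open>Halving is enough because the distance in the square is at most the sum of the
      coordinate distances.\<close>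
    show ?thesis
    proof (intro exI[of _ "e / 2"] conjI allI impI)
      show "e / 2 > 0" using e by simp
      fix a b c' d assume H: "0 \<le> a \<and> a \<le> x \<and> x \<le> b \<and> b \<le> 1 \<and> b - a < e / 2 \<and>
        0 \<le> c' \<and> c' \<le> y \<and> y \<le> d \<and> d \<le> 1 \<and> d - c' < e / 2"
      have "c ` ({a..b} \<times> {c'..d}) \<subseteq> V"
      proof clarify
        fix s t assume st: "s \<in> {a..b}" "t \<in> {c'..d}"
        have "dist (s, t) (x, y) \<le> \<bar>s - x\<bar> + \<bar>t - y\<bar>"
          unfolding dist_Pair_Pair dist_real_def by (metis abs_abs sqrt_sum_squares_le_sum_abs)
        also have "\<dots> < e" using st H by auto
        finally show "c (s, t) \<in> V" using e(2) st H by auto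
      qed
      then show "E ({a..b} \<times> {c'..d})"
        using primitive_over_single_primitive[OF V(2)] unfolding E_def by blast
    qed
  qed
  have strip: "\<exists>e>0. \<forall>c d. 0 \<le> c \<and> c \<le> y \<and> y \<le> d \<and> d \<le> 1 \<and> d - c < e \<longrightarrow> E ({0..1} \<times> {c..d})"
    if y: "y \<in> {0..1}" for y
  proof -
    \<comment> \<open>At the fixed height \<open>y\<close>, an interval is good if some thin strip
      over it carries a primitive; merging two intervals takes the smaller thickness. The bounds are
      a premise because bisection also asks about short intervals reaching outside
      \<open>{0..1}\<close>.\<close>
    define R where "R a b \<longleftrightarrow> (0 \<le> a \<and> a \<le> b \<and> b \<le> 1 \<longrightarrow>
      (\<exists>e>0. \<forall>c d. 0 \<le> c \<and> c \<le> y \<and> y \<le> d \<and> d \<le> 1 \<and> d - c < e \<longrightarrow> E ({a..b} \<times> {c..d})))" for a b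
    have "R 0 1"
    proof (rule Bolzano)
      show "(0::real) \<le> 1" by simp
      fix a b m assume ab: "R a b" "R b m" "a \<le> b" "b \<le> m"
      show "R a m"
        unfolding R_def
      proof
        assume am: "0 \<le> a \<and> a \<le> m \<and> m \<le> 1"
        obtain e1 where e1: "e1 > 0" "\<And>c d. 0 \<le> c \<and> c \<le> y \<and> y \<le> d \<and> d \<le> 1 \<and> d - c < e1 \<Longrightarrow> E ({a..b} \<times> {c..d})"
          using ab am unfolding R_def by (meson order.trans)
        obtain e2 where e2: "e2 > 0" "\<And>c d. 0 \<le> c \<and> c \<le> y \<and> y \<le> d \<and> d \<le> 1 \<and> d - c < e2 \<Longrightarrow> E ({b..m} \<times> {c..d})"
          using ab am unfolding R_def by (meson order.trans)
        have "E ({a..m} \<times> {c..d})" if cd: "0 \<le> c \<and> c \<le> y \<and> y \<le> d \<and> d \<le> 1 \<and> d - c < min e1 e2" for c d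
        proof -
          have int: "{a..b} \<times> {c..d} \<inter> {b..m} \<times> {c..d} = {b} \<times> {c..d}" using ab by auto
          have un: "{a..b} \<times> {c..d} \<union> {b..m} \<times> {c..d} = {a..m} \<times> {c..d}" using ab by auto
          have "E ({a..b} \<times> {c..d} \<union> {b..m} \<times> {c..d})"
          proof (rule glue)
            show "E ({a..b} \<times> {c..d})" by (rule e1(2)) (use cd in auto)
            show "E ({b..m} \<times> {c..d})" by (rule e2(2)) (use cd in auto)
            show "connected ({a..b} \<times> {c..d} \<inter> {b..m} \<times> {c..d})"
              unfolding int by (intro connected_Times) auto
            show "{a..b} \<times> {c..d} \<inter> {b..m} \<times> {c..d} \<noteq> {}"
              unfolding int using cd by auto
            show "{a..b} \<times> {c..d} \<union> {b..m} \<times> {c..d} \<subseteq> ?Q"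
              unfolding un using am cd by auto
          qed (auto intro: closed_Times)
          then show ?thesis unfolding un .
        qed
        then show "\<exists>e>0. \<forall>c d. 0 \<le> c \<and> c \<le> y \<and> y \<le> d \<and> d \<le> 1 \<and> d - c < e \<longrightarrow> E ({a..m} \<times> {c..d})"
          using e1(1) e2(1) by (intro exI[of _ "min e1 e2"]) auto
      qed
    next
      fix x :: real assume "0 \<le> x" "x \<le> 1"
      then obtain e where e: "e > 0" "\<And>a b c d. 0 \<le> a \<and> a \<le> x \<and> x \<le> b \<and> b \<le> 1 \<and> b - a < e \<and>
      0 \<le> c \<and> c \<le> y \<and> y \<le> d \<and> d \<le> 1 \<and> d - c < e \<Longrightarrow> E ({a..b} \<times> {c..d})"
        using small[of x y] y by auto
      have "R a b" if "a \<le> x \<and> x \<le> b \<and> b - a < e" for a b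
        unfolding R_def using e(1) e(2)[of a b] that by (intro impI exI[of _ e]) auto
      then show "\<exists>d>0. \<forall>a b. a \<le> x \<and> x \<le> b \<and> b - a < d \<longrightarrow> R a b"
        using e(1) by blast
    qed
    then show ?thesis by (simp add: R_def)
  qed
  \<comment> \<open>The pieces are now strips of full width, which \<open>strip\<close> provides
    near every height.\<close>
  define R where "R a b \<longleftrightarrow> (0 \<le> a \<and> a \<le> b \<and> b \<le> 1 \<longrightarrow> E ({0..1} \<times> {a..b}))" for a b
  have "R 0 1"
  proof (rule Bolzano)
    show "(0::real) \<le> 1" by simp
    fix a b m assume ab: "R a b" "R b m" "a \<le> b" "b \<le> m"
    show "R a m"
      unfolding R_def
    proof
      assume am: "0 \<le> a \<and> a \<le> m \<and> m \<le> 1"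
      have int: "{0..1} \<times> {a..b} \<inter> {0..1::real} \<times> {b..m} = {0..1} \<times> {b}" using ab by auto
      have un: "{0..1} \<times> {a..b} \<union> {0..1::real} \<times> {b..m} = {0..1} \<times> {a..m}" using ab by auto
      have "E ({0..1} \<times> {a..b} \<union> {0..1} \<times> {b..m})"
      proof (rule glue)
        show "E ({0..1} \<times> {a..b})" "E ({0..1} \<times> {b..m})"
          using ab am by (auto simp: R_def)
        show "connected ({0..1::real} \<times> {a..b} \<inter> {0..1} \<times> {b..m})"
          unfolding int by (intro connected_Times) auto
        show "{0..1::real} \<times> {a..b} \<inter> {0..1} \<times> {b..m} \<noteq> {}"
          unfolding int by auto
        show "{0..1::real} \<times> {a..b} \<union> {0..1} \<times> {b..m} \<subseteq> ?Q"
          unfolding un using am by auto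
      qed (auto intro: closed_Times)
      then show "E ({0..1} \<times> {a..m})" unfolding un .
    qed
  next
    fix x :: real assume "0 \<le> x" "x \<le> 1"
    then obtain e where "e > 0"
        "\<forall>c d. 0 \<le> c \<and> c \<le> x \<and> x \<le> d \<and> d \<le> 1 \<and> d - c < e \<longrightarrow> E ({0..1} \<times> {c..d})"
      using strip[of x] by auto
    then show "\<exists>d>0. \<forall>a b. a \<le> x \<and> x \<le> b \<and> b - a < d \<longrightarrow> R a b"
      unfolding R_def by (intro exI[of _ e]) auto
  qed
  then show ?thesis by (simp add: R_def E_def)
qed

text \<open>Extending the path to the square by ignoring the second coordinate, and restricting to
  the bottom side, avoids another bisection.\<close>

lemma primitive_over_unit_interval:
  assumes c: "continuous_map (top_of_set {0..1::real}) X c"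
  shows "\<exists>h. primitive_over X A \<alpha> {0..1::real} c h"
proof -
  have "continuous_map (top_of_set ({0..1::real} \<times> {0..1::real})) X (c \<circ> fst)"
    by (rule continuous_map_compose[OF _ c]) (auto intro!: continuous_intros)
  then obtain h where "primitive_over X A \<alpha> ({0..1::real} \<times> {0..1::real}) (c \<circ> fst) h"
    using primitive_over_unit_square by blast
  then have "primitive_over X A \<alpha> {0..1} ((c \<circ> fst) \<circ> (\<lambda>s. (s, 0::real))) (h \<circ> (\<lambda>s. (s, 0)))"
    by (rule primitive_over_compose) (auto intro!: continuous_intros)
  then show ?thesis
    by (auto simp: comp_def)
qed

text \<open>Uniqueness of primitives up to a constant is what makes the definite description
  meaningful.\<close>

lemma path_integral_eq:
  assumes c: "continuous_map (top_of_set {0..1}) X c" and h: "primitive_over X A \<alpha> {0..1} c h"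
  shows "path_integral X A \<alpha> c = h 1 - h 0"
  unfolding path_integral_def primitive_along_iff_primitive_over
proof (rule the_equality)
  fix I assume "\<exists>h. primitive_over X A \<alpha> {0..1} c h \<and> I = h 1 - h 0"
  then obtain h' where "primitive_over X A \<alpha> {0..1} c h'" "I = h' 1 - h' 0" by blast
  then have eq: "h 1 - h' 1 = h 0 - h' 0"
    using primitive_over_unique[OF h _ c, of h' 1 0] by simp
  have "h 1 - h 0 = (h 1 - h' 1) + h' 1 - ((h 0 - h' 0) + h' 0)" by simp
  also have "\<dots> = I" unfolding eq \<open>I = _\<close> by simp
  finally show "I = h 1 - h 0" by simp
qed (use h in blast)


lemma path_integral_const:
  assumes "p \<in> topspace X"
  shows "path_integral X A \<alpha> (\<lambda>t. p) = 0"
proof -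
  obtain V F where V: "p \<in> V" "primitive_on X A \<alpha> V F"
    using local_primitive[OF assms] by blast
  have "primitive_over X A \<alpha> {0..1::real} (\<lambda>t. p) (F \<circ> (\<lambda>t. p))"
    by (rule primitive_over_single_primitive[OF V(2)]) (use V(1) in auto)
  from path_integral_eq[OF _ this] show ?thesis
    using assms by simp
qed

end

section \<open>Singular simplices, chains and homology classes\<close>

definition edge_point :: "real \<Rightarrow> nat \<Rightarrow> real" where
  "edge_point t = (\<lambda>i. if i = 0 then 1 - t else if i = 1 then t else 0)"

text \<open>Polar coordinates around vertex 0: \<open>s\<close> is the weight taken away from vertex
  0 and \<open>t\<close> the position along the opposite side. The side \<open>s = 0\<close> of the
  square collapses to vertex 0.\<close>

definition triangle_point :: "real \<times> real \<Rightarrow> nat \<Rightarrow> real" where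
  "triangle_point = (\<lambda>(s, t) i. if i = 0 then 1 - s else if i = 1 then s * (1 - t) else if i = 2 then s * t else 0)"

lemma edge_point_in_standard_simplex: "t \<in> {0..1} \<Longrightarrow> edge_point t \<in> standard_simplex 1"
  by (auto simp: edge_point_def standard_simplex_def)

lemma triangle_point_in_standard_simplex:
  "st \<in> {0..1} \<times> {0..1} \<Longrightarrow> triangle_point st \<in> standard_simplex 2"
proof (clarsimp, goal_cases)
  case (1 s t)
  then have "0 \<le> s * t" "s * t \<le> s" by (auto simp: mult_left_le)
  with 1 show ?case
    by (auto simp: triangle_point_def standard_simplex_def numeral_2_eq_2 right_diff_distrib)
qed

lemma continuous_map_edge_point:
  "continuous_map (top_of_set {0..1}) (subtopology (powertop_real UNIV) (standard_simplex 1)) edge_point"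
  unfolding continuous_map_in_subtopology continuous_map_componentwise_UNIV
proof (intro conjI allI)
  show "continuous_map (top_of_set {0..1}) euclideanreal (\<lambda>t. edge_point t k)" for k
    by (cases "k = 0"; cases "k = 1") (auto simp: edge_point_def intro!: continuous_intros)
qed (use edge_point_in_standard_simplex in auto)

lemma continuous_map_triangle_point:
  "continuous_map (top_of_set ({0..1} \<times> {0..1})) (subtopology (powertop_real UNIV) (standard_simplex 2)) triangle_point"
  unfolding continuous_map_in_subtopology continuous_map_componentwise_UNIV
proof (intro conjI allI)
  show "continuous_map (top_of_set ({0..1} \<times> {0..1})) euclideanreal (\<lambda>t. triangle_point t k)" for k
    by (cases "k = 0"; cases "k = 1"; cases "k = 2")
       (auto simp: triangle_point_def case_prod_unfold intro!: continuous_intros)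
qed (use triangle_point_in_standard_simplex in auto)

text \<open>The faces are the sides \<open>s = 1\<close>, \<open>t = 1\<close> and
  \<open>t = 0\<close>; with the collapsed side they exhaust the boundary of the square.\<close>

lemma simplical_face_edge_point:
  "simplical_face 0 (edge_point t) = triangle_point (1, t)"
  "simplical_face 1 (edge_point t) = triangle_point (t, 1)"
  "simplical_face 2 (edge_point t) = triangle_point (t, 0)"
  by (auto simp: simplical_face_def edge_point_def triangle_point_def fun_eq_iff)

lemma simplex_integral_edge_point:
  "simplex_integral X A \<alpha> s = path_integral X A \<alpha> (\<lambda>t. s (edge_point t))"
  by (simp add: simplex_integral_def edge_point_def)

text \<open>Faces and images of singular simplices are restricted to the standard simplex, so the
  paths to be compared agree only for parameters in \<open>{0..1}\<close>.\<close>

lemma path_integral_cong: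
  assumes "\<And>t. t \<in> {0..1} \<Longrightarrow> c t = c' t"
  shows "path_integral X A \<alpha> c = path_integral X A \<alpha> c'"
proof -
  have "primitive_along X A \<alpha> c h = primitive_along X A \<alpha> c' h" for h
    unfolding primitive_along_def using assms by (metis (no_types, lifting))
  then show ?thesis by (simp add: path_integral_def)
qed

lemma chain_integral_eq_sum:
  assumes "finite K" "Poly_Mapping.keys c \<subseteq> K"
  shows "chain_integral X A \<alpha> c = (\<Sum>s\<in>K. of_int (Poly_Mapping.lookup c s) * simplex_integral X A \<alpha> s)"
  unfolding chain_integral_def
  by (rule sum.mono_neutral_left) (use assms in \<open>auto simp: in_keys_iff\<close>)

lemma chain_integral_add:
  "chain_integral X A \<alpha> (c + d) = chain_integral X A \<alpha> c + chain_integral X A \<alpha> d"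
proof -
  let ?K = "Poly_Mapping.keys c \<union> Poly_Mapping.keys d"
  have "Poly_Mapping.keys (c + d) \<subseteq> ?K" by (rule Poly_Mapping.keys_add)
  then show ?thesis
    by (simp add: chain_integral_eq_sum[of ?K] lookup_add sum.distrib distrib_right)
qed

lemma chain_integral_0 [simp]: "chain_integral X A \<alpha> 0 = 0"
  by (simp add: chain_integral_def)

lemma chain_integral_minus: "chain_integral X A \<alpha> (- c) = - chain_integral X A \<alpha> c"
  using chain_integral_add[of X A \<alpha> c "- c"] by (simp add: add_eq_0_iff2)

lemma chain_integral_diff:
  "chain_integral X A \<alpha> (c - d) = chain_integral X A \<alpha> c - chain_integral X A \<alpha> d"
  using chain_integral_add[of X A \<alpha> c "- d"] by (simp add: chain_integral_minus)

lemma chain_integral_of [simp]: "chain_integral X A \<alpha> (frag_of s) = simplex_integral X A \<alpha> s"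
  by (simp add: chain_integral_def)

lemma homology_group_1_cases:
  assumes "C \<in> carrier (homology_group 1 X)"
  obtains c where "singular_relcycle 1 X {} c" "C = homologous_rel_set 1 X {} c"
  using assms carrier_relative_homology_group[of 1 X "{}"] by auto

context locally_exact_form
begin

text \<open>With a primitive \<open>h\<close> over the whole square, each face contributes a
  difference of corner values. The alternating sum telescopes to \<open>h (0, 1) - h (0, 0)\<close>,
  the integral over the collapsed side, which is a constant path.\<close>

lemma chain_integral_boundary_simplex:
  assumes s: "singular_simplex 2 X s"
  shows "chain_integral X A \<alpha> (chain_boundary 2 (frag_of s)) = 0"
proof -
  let ?c = "s \<circ> triangle_point"
  have c: "continuous_map (top_of_set ({0..1} \<times> {0..1})) X ?c"
    using s by (intro continuous_map_compose[OF continuous_map_triangle_point]) (simp add: singular_simplex_def)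
  then obtain h where h: "primitive_over X A \<alpha> ({0..1} \<times> {0..1}) ?c h"
    using primitive_over_unit_square by blast
  have edge: "path_integral X A \<alpha> (?c \<circ> g) = h (g 1) - h (g 0)"
    if g: "continuous_on {0..1} g" "g ` {0..1} \<subseteq> {0..1} \<times> {0..1}" for g :: "real \<Rightarrow> real \<times> real"
  proof -
    have "continuous_map (top_of_set {0..1}) (top_of_set ({0..1} \<times> {0..1})) g"
      using g by auto
    from path_integral_eq[OF continuous_map_compose[OF this c] primitive_over_compose[OF h g]]
    show ?thesis by simp
  qed
  have face: "simplex_integral X A \<alpha> (singular_face 2 k s) = path_integral X A \<alpha> (\<lambda>t. s (simplical_face k (edge_point t)))"
    for k
    unfolding simplex_integral_edge_point singular_face_def
    using edge_point_in_standard_simplex by (intro path_integral_cong) simp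
  have pair: "continuous_on {0..1} (\<lambda>t::real. (a::real, t))" "continuous_on {0..1} (\<lambda>t::real. (t, a))" for a
    by (intro continuous_intros)+
  have img: "(\<lambda>t. (a, t)) ` {0..1} \<subseteq> {0..1} \<times> {0..1}" "(\<lambda>t. (t, a)) ` {0..1} \<subseteq> {0..1} \<times> {0..1}"
    if "a \<in> {0..1}" for a :: real
    using that by auto
  have "simplex_integral X A \<alpha> (singular_face 2 0 s) = h (1, 1) - h (1, 0)"
    using edge[of "\<lambda>t. (1, t)", OF pair(1) img(1)] unfolding face simplical_face_edge_point
    by (auto simp: comp_def)
  moreover have "simplex_integral X A \<alpha> (singular_face 2 1 s) = h (1, 1) - h (0, 1)"
    using edge[of "\<lambda>t. (t, 1)", OF pair(2) img(2)] unfolding face simplical_face_edge_point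
    by (auto simp: comp_def)
  moreover have "simplex_integral X A \<alpha> (singular_face 2 2 s) = h (1, 0) - h (0, 0)"
    using edge[of "\<lambda>t. (t, 0)", OF pair(2) img(2)] unfolding face simplical_face_edge_point
    by (auto simp: comp_def)
  moreover have "h (0, 1) - h (0, 0) = 0"
  proof -
    have const: "triangle_point (0, t) = triangle_point (0, 0)" for t
      by (auto simp: triangle_point_def fun_eq_iff)
    have "?c (0, 0) \<in> topspace X"
      using continuous_map_image_subset_topspace[OF c] by force
    then have "path_integral X A \<alpha> (\<lambda>t. ?c (0, 0)) = 0"
      by (rule path_integral_const)
    moreover have "?c \<circ> (\<lambda>t. (0, t)) = (\<lambda>t. ?c (0, 0))"
      unfolding comp_def by (intro ext arg_cong[of _ _ s] const)
    ultimately show ?thesis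
      using edge[of "\<lambda>t. (0, t)", OF pair(1) img(1)] by auto
  qed
  ultimately have "simplex_integral X A \<alpha> (singular_face 2 0 s) - simplex_integral X A \<alpha> (singular_face 2 1 s)
      + simplex_integral X A \<alpha> (singular_face 2 2 s) = 0"
    by simp
  then show ?thesis
    by (simp add: chain_boundary_of numeral_2_eq_2 chain_integral_add chain_integral_minus chain_integral_diff)
qed

lemma chain_integral_boundary:
  assumes "singular_chain 2 X c"
  shows "chain_integral X A \<alpha> (chain_boundary 2 c) = 0"
proof -
  have "Poly_Mapping.keys c \<subseteq> singular_simplex_set 2 X"
    using assms by (simp add: singular_chain_def)
  then show ?thesis
    by (induction c rule: frag_induction)
       (auto simp: chain_integral_boundary_simplex chain_boundary_diff chain_integral_diff)
qed

text \<open>Members of one class differ by the boundary of a 2-chain, over which the integral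
  vanishes, so the definite description picks their common value.\<close>

lemma homology_integral_eq:
  assumes "C \<in> carrier (homology_group 1 X)" "c \<in> C"
  shows "homology_integral X A \<alpha> C = chain_integral X A \<alpha> c"
proof -
  obtain c0 where C: "C = homologous_rel_set 1 X {} c0"
    using assms(1) by (rule homology_group_1_cases)
  have eq: "chain_integral X A \<alpha> d = chain_integral X A \<alpha> c0" if "d \<in> C" for d
  proof -
    have "\<exists>e. singular_chain 2 X e \<and> chain_boundary 2 e = c0 - d"
      using that unfolding C homologous_rel_def mem_Collect_eq singular_boundary
      by (simp add: numeral_2_eq_2)
    then obtain e where "singular_chain 2 X e" "chain_boundary 2 e = c0 - d"
      by blast
    then show ?thesis
      using chain_integral_boundary[of e] by (simp add: chain_integral_diff)
  qed
  show ?thesis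
    unfolding homology_integral_def
    by (rule the_equality) (use eq assms(2) in auto)
qed

lemma homology_integral_mult:
  assumes "C \<in> carrier (homology_group 1 X)" "D \<in> carrier (homology_group 1 X)"
  shows "homology_integral X A \<alpha> (C \<otimes>\<^bsub>homology_group 1 X\<^esub> D) =
    homology_integral X A \<alpha> C + homology_integral X A \<alpha> D"
proof -
  obtain c d where "C = homologous_rel_set 1 X {} c" "D = homologous_rel_set 1 X {} d"
    using assms homology_group_1_cases by metis
  then have cd: "c \<in> C" "d \<in> D" by simp_all
  have "c + d \<in> C \<otimes>\<^bsub>homology_group 1 X\<^esub> D"
    using cd mult_relative_homology_group[of 1 X "{}"] by auto
  moreover have "C \<otimes>\<^bsub>homology_group 1 X\<^esub> D \<in> carrier (homology_group 1 X)"
    by (rule monoid.m_closed[OF group.is_monoid[OF group_relative_homology_group] assms])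
  ultimately show ?thesis
    using cd assms by (simp add: homology_integral_eq chain_integral_add)
qed

end

text \<open>Change of variables. The factor \<open>k\<close> is carried along so that forms agreeing
  with a pullback up to sign can be compared without a separate appeal to linearity in the
  form.\<close>

lemma homology_integral_hom_induced:
  assumes "locally_exact_form X A \<alpha>" "locally_exact_form Y B \<beta>"
    and f: "continuous_map Y X f"
    and pull: "\<And>V F. primitive_on X A \<alpha> V F \<Longrightarrow>
       primitive_on Y B \<beta> {q \<in> topspace Y. f q \<in> V} (\<lambda>q. k * F (f q))"
    and C: "C \<in> carrier (homology_group 1 Y)"
  shows "homology_integral Y B \<beta> C = k * homology_integral X A \<alpha> (hom_induced 1 Y {} X {} f C)"
proof -
  interpret X: locally_exact_form X A \<alpha> by fact
  interpret Y: locally_exact_form Y B \<beta> by fact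
  have simplex: "simplex_integral Y B \<beta> s = k * simplex_integral X A \<alpha> (simplex_map 1 f s)"
    if s: "singular_simplex 1 Y s" for s
  proof -
    let ?c = "s \<circ> edge_point"
    have c: "continuous_map (top_of_set {0..1}) Y ?c"
      using s by (intro continuous_map_compose[OF continuous_map_edge_point]) (simp add: singular_simplex_def)
    have fc: "continuous_map (top_of_set {0..1}) X (f \<circ> ?c)"
      by (rule continuous_map_compose[OF c f])
    obtain h where h: "primitive_over X A \<alpha> {0..1} (f \<circ> ?c) h"
      using X.primitive_over_unit_interval[OF fc] by blast
    have "?c ` {0..1} \<subseteq> topspace Y"
      using continuous_map_image_subset_topspace[OF c] by simp
    then have "primitive_over Y B \<beta> {0..1} ?c (\<lambda>t. k * h t)"
      by (rule primitive_over_push[OF h _ pull])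
    then have "path_integral Y B \<beta> ?c = k * path_integral X A \<alpha> (f \<circ> ?c)"
      using X.path_integral_eq[OF fc h] Y.path_integral_eq[OF c] by (simp add: right_diff_distrib)
    moreover have "path_integral X A \<alpha> (\<lambda>t. simplex_map 1 f s (edge_point t)) = path_integral X A \<alpha> (f \<circ> ?c)"
      using edge_point_in_standard_simplex by (intro path_integral_cong) (simp add: simplex_map_def)
    ultimately show ?thesis
      by (simp add: simplex_integral_edge_point comp_def)
  qed
  have chain: "chain_integral Y B \<beta> c = k * chain_integral X A \<alpha> (chain_map 1 f c)"
    if "Poly_Mapping.keys c \<subseteq> singular_simplex_set 1 Y" for c
    using that
    by (induction c rule: frag_induction) (auto simp: simplex chain_map_diff chain_integral_diff right_diff_distrib simp del: One_nat_def)
  obtain c where c: "singular_relcycle 1 Y {} c" "C = homologous_rel_set 1 Y {} c"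
    using C by (rule homology_group_1_cases)
  have fC: "hom_induced 1 Y {} X {} f C = homologous_rel_set 1 X {} (chain_map 1 f c)"
    using hom_induced_chain_map[of Y X f "{}" "{}" 1 c] f c by simp
  have "chain_map 1 f c \<in> hom_induced 1 Y {} X {} f C" "c \<in> C"
    unfolding fC unfolding c(2) by auto
  moreover have "hom_induced 1 Y {} X {} f C \<in> carrier (homology_group 1 X)"
    by (rule hom_induced_carrier)
  moreover have "Poly_Mapping.keys c \<subseteq> singular_simplex_set 1 Y"
    using c(1) by (simp add: singular_relcycle_def singular_chain_def)
  ultimately show ?thesis
    using X.homology_integral_eq Y.homology_integral_eq[OF C] chain by simp
qed

section \<open>Charts of the hyperelliptic curve\<close>

lemma coordinate_chartI:
  assumes U: "openin X U" and B: "open B"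
    and \<phi>: "continuous_map (subtopology X U) euclidean \<phi>"
    and k: "continuous_map (top_of_set B) X k"
    and kB: "\<And>z. z \<in> B \<Longrightarrow> k z \<in> U \<and> \<phi> (k z) = z"
    and \<phi>U: "\<And>q. q \<in> U \<Longrightarrow> \<phi> q \<in> B \<and> k (\<phi> q) = q"
  shows "coordinate_chart X U \<phi>"
proof -
  have im: "\<phi> ` U = B"
    using kB \<phi>U by (metis image_eqI image_subsetI subsetI subset_antisym)
  have top: "topspace (subtopology X U) = U"
    using openin_subset[OF U] by auto
  have "homeomorphic_maps (subtopology X U) (top_of_set B) \<phi> k"
    unfolding homeomorphic_maps_def
    using \<phi> k kB \<phi>U top by (auto simp: continuous_map_in_subtopology)
  then show ?thesis
    unfolding coordinate_chart_def im homeomorphic_map_maps using U B by blast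
qed

lemma coordinate_chartD:
  assumes "coordinate_chart X U \<phi>"
  shows coordinate_chart_open_image: "open (\<phi> ` U)"
    and coordinate_chart_inj: "inj_on \<phi> U"
    and coordinate_chart_continuous: "continuous_map (subtopology X U) euclidean \<phi>"
    and coordinate_chart_inverse: "continuous_map (top_of_set (\<phi> ` U)) X (inv_into U \<phi>)"
proof -
  have UX: "openin X U" and hom: "homeomorphic_map (subtopology X U) (top_of_set (\<phi> ` U)) \<phi>"
    using assms by (auto simp: coordinate_chart_def)
  have top: "topspace (subtopology X U) = U"
    using openin_subset[OF UX] by auto
  show "open (\<phi> ` U)" using assms by (simp add: coordinate_chart_def)
  show inj: "inj_on \<phi> U"
    using homeomorphic_imp_injective_map[OF hom] top by simp
  show "continuous_map (subtopology X U) euclidean \<phi>"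
    using homeomorphic_imp_continuous_map[OF hom] continuous_map_in_subtopology by blast
  obtain k where k: "homeomorphic_maps (subtopology X U) (top_of_set (\<phi> ` U)) \<phi> k"
    using hom homeomorphic_map_maps by blast
  then have "continuous_map (top_of_set (\<phi> ` U)) X k"
    unfolding homeomorphic_maps_def continuous_map_in_subtopology by blast
  moreover have "k z = inv_into U \<phi> z" if "z \<in> topspace (top_of_set (\<phi> ` U))" for z
    using that k top inj unfolding homeomorphic_maps_def by (auto simp: inv_into_f_f)
  ultimately show "continuous_map (top_of_set (\<phi> ` U)) X (inv_into U \<phi>)"
    by (rule continuous_map_eq)
qed

text \<open>Implicit differentiation for a merely continuous \<open>g\<close>, as chart inverses are
  known only to be continuous. Caratheodory's factorisation
  \<open>F z - F (g a) = q z * (z - g a)\<close> lets the difference quotient of \<open>g\<close> be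
  solved for, since \<open>q (g z)\<close> tends to \<open>F' \<noteq> 0\<close>.\<close>

lemma has_field_derivative_implicit:
  fixes g :: "'a::real_normed_field \<Rightarrow> 'a"
  assumes F: "(F has_field_derivative F') (at (g a))" "F' \<noteq> 0"
    and K: "(K has_field_derivative K') (at a)"
    and g: "isCont g a" and eq: "\<forall>\<^sub>F z in nhds a. F (g z) = K z"
  shows "(g has_field_derivative K' / F') (at a)"
proof -
  obtain q where q: "\<And>z. F z - F (g a) = q z * (z - g a)" "isCont q (g a)" "q (g a) = F'"
    using F(1) unfolding CARAT_DERIV by blast
  have qg: "(\<lambda>z. q (g z)) \<midarrow>a\<rightarrow> F'"
    using isCont_o2[OF g q(2)] q(3) by (simp add: isCont_def)
  have "(\<lambda>z. (K z - K a) / (z - a) / q (g z)) \<midarrow>a\<rightarrow> K' / F'"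
    by (intro tendsto_divide qg F(2)) (use K in \<open>simp add: has_field_derivative_iff\<close>)
  moreover have "\<forall>\<^sub>F z in at a. (K z - K a) / (z - a) / q (g z) = (g z - g a) / (z - a)"
  proof -
    have "\<forall>\<^sub>F z in at a. q (g z) \<noteq> 0"
      using qg F(2) by (rule tendsto_imp_eventually_ne)
    moreover have "\<forall>\<^sub>F z in at a. F (g z) = K z"
      using eq by (simp add: eventually_at_filter eventually_mono)
    moreover have "\<forall>\<^sub>F z in at a. z \<noteq> a" by (simp add: eventually_at_filter)
    ultimately show ?thesis
    proof eventually_elim
      case (elim z)
      have "K z - K a = q (g z) * (g z - g a)" using q(1)[of "g z"] elim eventually_nhds_x_imp_x[OF eq] by simp
      then show ?case using elim by simp
    qed
  qed
  ultimately show ?thesis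
    unfolding has_field_derivative_iff by (rule Lim_transform_eventually)
qed

section \<open>The curve polynomial and the gluing of the two affine pieces\<close>

definition curve_poly :: "complex \<Rightarrow> complex" where
  "curve_poly w = w ^ 8 - 14 * w ^ 4 + 1"

definition curve_poly' :: "complex \<Rightarrow> complex" where
  "curve_poly' w = 8 * w ^ 7 - 56 * w ^ 3"

lemma curve_poly_deriv: "(curve_poly has_field_derivative curve_poly' w) (at w)"
  unfolding curve_poly_def[abs_def] curve_poly'_def by (auto intro!: derivative_eq_intros)

text \<open>The critical points are \<open>w = 0\<close> and \<open>w ^ 4 = 7\<close>, with values 1
  and 49 - 98 + 1 = -48. Hence \<open>y\<close> is a local coordinate at the branch points.\<close>

lemma curve_poly_simple_roots:
  assumes "curve_poly w = 0"
  shows "curve_poly' w \<noteq> 0"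
proof
  assume "curve_poly' w = 0"
  then have "w ^ 3 * (w ^ 4 - 7) = 0"
    by (simp add: curve_poly'_def algebra_simps flip: power_add)
  then consider "w = 0" | "w ^ 4 = 7" by auto
  then show False
  proof cases
    case 2
    have "(w ^ 4)\<^sup>2 - 14 * w ^ 4 + 1 = 0"
      using assms by (simp add: curve_poly_def flip: power_mult)
    then show False unfolding 2 by simp
  qed (use assms in \<open>simp add: curve_poly_def\<close>)
qed

lemma in_affine_curve_iff: "(w, y) \<in> affine_curve \<longleftrightarrow> y\<^sup>2 = curve_poly w"
  by (simp add: affine_curve_def curve_poly_def)

text \<open>The polynomial is palindromic, so both pieces are the same curve and facts about the
  second one can be stated on \<open>affine_curve\<close>.\<close>

lemma affine_curve_inf_eq: "affine_curve_inf = affine_curve"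
  by (auto simp: affine_curve_def affine_curve_inf_def)

lemma curve_poly_inverse:
  assumes "w \<noteq> 0"
  shows "curve_poly (1 / w) = curve_poly w / w ^ 8"
proof -
  have "w ^ 8 = w ^ 4 * w ^ 4" by (simp flip: power_add)
  then show ?thesis
    using assms by (simp add: curve_poly_def power_one_over field_simps)
qed

lemma invert_in_affine_curve:
  assumes "w \<noteq> 0"
  shows "(1 / w, y / w ^ 4) \<in> affine_curve \<longleftrightarrow> (w, y) \<in> affine_curve"
  using assms by (simp add: in_affine_curve_iff curve_poly_inverse power_divide flip: power_mult)

lemma Aff_in_curve_points_iff: "Aff w y \<in> curve_points \<longleftrightarrow> y\<^sup>2 = curve_poly w"
proof
  assume "Aff w y \<in> curve_points"
  then consider "(w, y) \<in> affine_curve" | u v where "(u, v) \<in> affine_curve" "u \<noteq> 0" "w = 1 / u" "y = v / u ^ 4"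
    by (auto simp: curve_points_def glue_def glue_inf_def affine_curve_inf_eq split: if_splits)
  then show "y\<^sup>2 = curve_poly w"
    by cases (auto simp: in_affine_curve_iff[symmetric] invert_in_affine_curve)
next
  assume "y\<^sup>2 = curve_poly w"
  then have "glue (w, y) \<in> curve_points"
    unfolding curve_points_def in_affine_curve_iff[symmetric] by blast
  then show "Aff w y \<in> curve_points" by (simp add: glue_def)
qed

lemma Infty_in_curve_points: "Infty v \<in> curve_points \<Longrightarrow> v\<^sup>2 = 1"
  by (auto simp: curve_points_def glue_def glue_inf_def affine_curve_inf_def split: if_splits)

lemma glue_inf_inverse: "w \<noteq> 0 \<Longrightarrow> glue_inf (1 / w, y / w ^ 4) = Aff w y"
  by (simp add: glue_inf_def power_divide)

lemma inj_glue: "inj glue"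
  by (auto simp: inj_on_def glue_def)

lemma inj_glue_inf: "inj glue_inf"
  by (auto simp: inj_on_def glue_inf_def split: if_splits)

text \<open>Openness in the glued curve is tested on both pieces. An open set of one piece appears
  in the other as its preimage under the transition map, which is the set considered here.\<close>

lemma openin_invert:
  assumes "open W"
  shows "openin (top_of_set affine_curve)
    {(w, y). (w, y) \<in> affine_curve \<and> w \<noteq> 0 \<and> (1 / w, y / w ^ 4) \<in> W}"
proof -
  let ?S = "{p :: complex \<times> complex. fst p \<noteq> 0}"
  let ?g = "\<lambda>p :: complex \<times> complex. (1 / fst p, snd p / fst p ^ 4)"
  have S: "open ?S" by (intro open_Collect_neq continuous_intros)
  have "continuous_on ?S ?g" by (intro continuous_intros) auto
  then have "open (?S \<inter> ?g -` W)"
    using S assms by (rule continuous_open_preimage)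
  moreover have "{(w, y). (w, y) \<in> affine_curve \<and> w \<noteq> 0 \<and> (1 / w, y / w ^ 4) \<in> W} =
      affine_curve \<inter> (?S \<inter> ?g -` W)"
    by auto
  ultimately show ?thesis by (simp only: openin_open_Int)
qed

lemma openin_glue_image:
  assumes "open W"
  shows "openin Sigma_curve (glue ` (W \<inter> affine_curve))"
  unfolding openin_Sigma_curve curve_open_def
proof (intro conjI)
  have "affine_curve \<inter> glue -` (glue ` (W \<inter> affine_curve)) = affine_curve \<inter> W"
    by (auto dest: injD[OF inj_glue])
  then show "openin (top_of_set affine_curve) (affine_curve \<inter> glue -` (glue ` (W \<inter> affine_curve)))"
    using assms by auto
  have "affine_curve_inf \<inter> glue_inf -` (glue ` (W \<inter> affine_curve)) =
      {(w, y). (w, y) \<in> affine_curve \<and> w \<noteq> 0 \<and> (1 / w, y / w ^ 4) \<in> W}"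
    by (auto simp: affine_curve_inf_eq glue_def glue_inf_def invert_in_affine_curve image_iff Bex_def split: if_splits)
  then show "openin (top_of_set affine_curve_inf) (affine_curve_inf \<inter> glue_inf -` (glue ` (W \<inter> affine_curve)))"
    using openin_invert[OF assms] affine_curve_inf_eq by simp
qed (auto simp: curve_points_def)

lemma openin_glue_inf_image:
  assumes "open W"
  shows "openin Sigma_curve (glue_inf ` (W \<inter> affine_curve))"
  unfolding openin_Sigma_curve curve_open_def
proof (intro conjI)
  have "affine_curve_inf \<inter> glue_inf -` (glue_inf ` (W \<inter> affine_curve)) = affine_curve \<inter> W"
    by (auto simp: affine_curve_inf_eq dest: injD[OF inj_glue_inf])
  then show "openin (top_of_set affine_curve_inf) (affine_curve_inf \<inter> glue_inf -` (glue_inf ` (W \<inter> affine_curve)))"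
    using assms by (auto simp: affine_curve_inf_eq)
  have "glue (w, y) \<in> glue_inf ` (W \<inter> affine_curve) \<longleftrightarrow> w \<noteq> 0 \<and> (1 / w, y / w ^ 4) \<in> W"
    if "(w, y) \<in> affine_curve" for w y
  proof
    assume "glue (w, y) \<in> glue_inf ` (W \<inter> affine_curve)"
    then show "w \<noteq> 0 \<and> (1 / w, y / w ^ 4) \<in> W"
      by (auto simp: glue_def glue_inf_def power_divide split: if_splits)
  next
    assume "w \<noteq> 0 \<and> (1 / w, y / w ^ 4) \<in> W"
    then show "glue (w, y) \<in> glue_inf ` (W \<inter> affine_curve)"
      using glue_inf_inverse[of w y] invert_in_affine_curve[of w y] that
      by (intro image_eqI[of _ _ "(1 / w, y / w ^ 4)"]) (auto simp: glue_def)
  qed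
  then have "affine_curve \<inter> glue -` (glue_inf ` (W \<inter> affine_curve)) =
      {(w, y). (w, y) \<in> affine_curve \<and> w \<noteq> 0 \<and> (1 / w, y / w ^ 4) \<in> W}"
    by auto
  then show "openin (top_of_set affine_curve) (affine_curve \<inter> glue -` (glue_inf ` (W \<inter> affine_curve)))"
    using openin_invert[OF assms] by simp
qed (auto simp: curve_points_def affine_curve_inf_eq)

lemma continuous_map_glue: "continuous_map (top_of_set affine_curve) Sigma_curve glue"
proof -
  have "{x \<in> affine_curve. glue x \<in> W} = affine_curve \<inter> glue -` W" for W by auto
  then show ?thesis
    by (auto simp: continuous_map_def topspace_Sigma_curve openin_Sigma_curve curve_open_def curve_points_def)
qed

lemma continuous_map_glue_inf: "continuous_map (top_of_set affine_curve) Sigma_curve glue_inf"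
proof -
  have "{x \<in> affine_curve. glue_inf x \<in> W} = affine_curve \<inter> glue_inf -` W" for W by auto
  then show ?thesis
    by (auto simp: continuous_map_def topspace_Sigma_curve openin_Sigma_curve curve_open_def
        curve_points_def affine_curve_inf_eq)
qed

text \<open>\<open>j\<close> is the gluing map of one of the two affine pieces, and \<open>pr\<close> the projection that \<open>k\<close> inverts.\<close>

lemma coordinate_chart_graph:
  fixes j :: "complex \<times> complex \<Rightarrow> curve_point" and pr :: "complex \<times> complex \<Rightarrow> complex"
  assumes j: "continuous_map (top_of_set affine_curve) Sigma_curve j" "inj j"
      "\<And>W. open W \<Longrightarrow> openin Sigma_curve (j ` (W \<inter> affine_curve))"
    and pr: "continuous_on UNIV pr" "\<And>p. \<phi> (j p) = pr p"
    and B: "open B" "open W" "continuous_on B k" "\<And>z. z \<in> B \<Longrightarrow> pr (k z) = z"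
      "k ` B = W \<inter> affine_curve"
  shows "coordinate_chart Sigma_curve (j ` (W \<inter> affine_curve)) \<phi>"
proof (rule coordinate_chartI[where B = B and k = "j \<circ> k"])
  let ?U = "j ` (W \<inter> affine_curve)"
  show U: "openin Sigma_curve ?U" by (rule j(3)[OF B(2)])
  show "continuous_map (subtopology Sigma_curve ?U) euclidean \<phi>"
    unfolding continuous_map_def
  proof (intro conjI allI impI)
    fix V :: "complex set" assume "openin euclidean V"
    then have "open (W \<inter> pr -` V)"
      using B(2) pr(1) by (simp add: continuous_on_open_vimage open_Int)
    from j(3)[OF this] have "openin Sigma_curve (j ` (W \<inter> pr -` V \<inter> affine_curve))" .
    moreover have "{x \<in> topspace (subtopology Sigma_curve ?U). \<phi> x \<in> V} = j ` (W \<inter> pr -` V \<inter> affine_curve)"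
      using openin_subset[OF U] pr(2) by auto
    ultimately show "openin (subtopology Sigma_curve ?U) {x \<in> topspace (subtopology Sigma_curve ?U). \<phi> x \<in> V}"
      unfolding openin_open_subtopology[OF U] by auto
  qed auto
  have "continuous_map (top_of_set B) (top_of_set affine_curve) k"
    using B(3,5) by auto
  then show "continuous_map (top_of_set B) Sigma_curve (j \<circ> k)"
    by (rule continuous_map_compose[OF _ j(1)])
  show "(j \<circ> k) z \<in> ?U \<and> \<phi> ((j \<circ> k) z) = z" if "z \<in> B" for z
    using that B(4,5) pr(2) by auto
  show "\<phi> q \<in> B \<and> (j \<circ> k) (\<phi> q) = q" if "q \<in> ?U" for q
  proof -
    have "q \<in> j ` k ` B" using that unfolding B(5) .
    then obtain z where "z \<in> B" "q = j (k z)" by blast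
    then show ?thesis using B(4) pr(2) by simp
  qed
qed (rule B(1))

text \<open>The total functions \<open>w_coord\<close> and \<open>y_coord\<close> are not continuous
  at infinity, so continuity of the coordinates along a chart is obtained locally: choosing for
  \<open>W\<close> a product with \<open>UNIV\<close> controls one coordinate at a time.\<close>

lemma eventually_in_glue_image:
  assumes "continuous_map (top_of_set B) Sigma_curve \<psi>" "open B" "z0 \<in> B"
    and "\<psi> z0 = Aff w y" "open W" "(w, y) \<in> W"
  shows "\<forall>\<^sub>F z in nhds z0. \<psi> z \<in> glue ` (W \<inter> affine_curve)"
proof -
  have "\<psi> z0 \<in> curve_points"
    using assms(1,3) by (auto simp: continuous_map_def topspace_Sigma_curve)
  then have "\<psi> z0 \<in> glue ` (W \<inter> affine_curve)"
    using assms(4,6)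
    by (intro image_eqI[of _ _ "(w, y)"]) (auto simp: Aff_in_curve_points_iff glue_def in_affine_curve_iff)
  from eventually_nhds_continuous_map[OF assms(1) openin_glue_image[OF assms(5)] assms(3) this]
    eventually_nhds_in_open[OF assms(2,3)]
  show ?thesis by eventually_elim simp
qed

lemma eventually_in_glue_inf_image:
  assumes "continuous_map (top_of_set B) Sigma_curve \<psi>" "open B" "z0 \<in> B"
    and "\<psi> z0 = Infty v" "open W" "(0, v) \<in> W"
  shows "\<forall>\<^sub>F z in nhds z0. \<psi> z \<in> glue_inf ` (W \<inter> affine_curve)"
proof -
  have "\<psi> z0 \<in> curve_points"
    using assms(1,3) by (auto simp: continuous_map_def topspace_Sigma_curve)
  then have "\<psi> z0 \<in> glue_inf ` (W \<inter> affine_curve)"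
    using assms(4,6) Infty_in_curve_points[of v]
    by (intro image_eqI[of _ _ "(0, v)"]) (auto simp: glue_inf_def in_affine_curve_iff curve_poly_def)
  from eventually_nhds_continuous_map[OF assms(1) openin_glue_inf_image[OF assms(5)] assms(3) this]
    eventually_nhds_in_open[OF assms(2,3)]
  show ?thesis by eventually_elim simp
qed

section \<open>Quadratic forms in the charts\<close>

lemma Sigma_atlas_cases:
  assumes "(U, \<phi>) \<in> Sigma_atlas"
  obtains (w) "\<phi> = w_coord" "U \<subseteq> {Aff w y | w y. y \<noteq> 0}"
    | (y) "\<phi> = y_coord" "U \<subseteq> {Aff w y | w y. curve_poly' w \<noteq> 0}"
    | (u) "\<phi> = u_coord" "U \<subseteq> {Aff w y | w y. w \<noteq> 0 \<and> y \<noteq> 0} \<union> range Infty"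
  using assms unfolding Sigma_atlas_def curve_poly'_def by blast

lemma Sigma_atlas_chart: "(U, \<phi>) \<in> Sigma_atlas \<Longrightarrow> coordinate_chart Sigma_curve U \<phi>"
  unfolding Sigma_atlas_def by blast

lemma coordinate_chart_eventually_inverse:
  assumes "coordinate_chart X U \<phi>" "q \<in> U"
  shows "\<forall>\<^sub>F z in nhds (\<phi> q). inv_into U \<phi> z \<in> U \<and> \<phi> (inv_into U \<phi> z) = z"
  using eventually_nhds_in_open[OF coordinate_chart_open_image[OF assms(1)], of "\<phi> q"] assms(2)
  by (auto elim!: eventually_mono intro: inv_into_into f_inv_into_f)

text \<open>These are the data for implicit differentiation in an arbitrary chart: both affine
  coordinates are continuous at the point and satisfy the curve equation nearby.\<close>

lemma coordinate_chart_affine_coords: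
  assumes U: "coordinate_chart Sigma_curve U \<phi>" "Aff w y \<in> U"
  defines "W \<equiv> \<lambda>z. w_coord (inv_into U \<phi> z)" and "Y \<equiv> \<lambda>z. y_coord (inv_into U \<phi> z)"
    and "z0 \<equiv> \<phi> (Aff w y)"
  shows "W z0 = w" "Y z0 = y" "isCont W z0" "isCont Y z0"
    and "\<forall>\<^sub>F z in nhds z0. Aff (W z) (Y z) \<in> U \<and> \<phi> (Aff (W z) (Y z)) = z \<and>
          (Y z)\<^sup>2 = curve_poly (W z)"
proof -
  let ?\<psi> = "inv_into U \<phi>"
  have \<psi>: "?\<psi> z0 = Aff w y"
    unfolding z0_def using coordinate_chart_inj[OF U(1)] U(2) by (rule inv_into_f_f)
  note ev = eventually_in_glue_image[OF coordinate_chart_inverse[OF U(1)]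
      coordinate_chart_open_image[OF U(1)] _ \<psi>]
  have z0: "z0 \<in> \<phi> ` U" using U(2) by (simp add: z0_def)
  show W: "W z0 = w" by (simp add: W_def \<psi>)
  show Y: "Y z0 = y" by (simp add: Y_def \<psi>)
  show "isCont W z0"
    unfolding isCont_def tendsto_def eventually_at_filter W
  proof (intro allI impI)
    fix S :: "complex set" assume "open S" "w \<in> S"
    from ev[of "S \<times> UNIV", OF z0] this
    show "\<forall>\<^sub>F z in nhds z0. z \<noteq> z0 \<longrightarrow> z \<in> UNIV \<longrightarrow> W z \<in> S"
      by (auto simp: open_Times W_def glue_def elim!: eventually_mono)
  qed
  show "isCont Y z0"
    unfolding isCont_def tendsto_def eventually_at_filter Y
  proof (intro allI impI)
    fix S :: "complex set" assume "open S" "y \<in> S"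
    from ev[of "UNIV \<times> S", OF z0] this
    show "\<forall>\<^sub>F z in nhds z0. z \<noteq> z0 \<longrightarrow> z \<in> UNIV \<longrightarrow> Y z \<in> S"
      by (auto simp: open_Times Y_def glue_def elim!: eventually_mono)
  qed
  have "\<forall>\<^sub>F z in nhds z0. ?\<psi> z \<in> glue ` (UNIV \<inter> affine_curve)"
    by (rule ev[OF z0]) auto
  then show "\<forall>\<^sub>F z in nhds z0. Aff (W z) (Y z) \<in> U \<and> \<phi> (Aff (W z) (Y z)) = z \<and>
          (Y z)\<^sup>2 = curve_poly (W z)"
    using coordinate_chart_eventually_inverse[OF U, folded z0_def]
    by eventually_elim (auto simp: glue_def W_def Y_def in_affine_curve_iff)
qed

lemma square_deriv: "((\<lambda>y. y\<^sup>2) has_field_derivative 2 * y) (at (y :: complex))"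
  by (auto intro!: derivative_eq_intros)

text \<open>Along the chart \<open>w\<close> is the identity, and implicit differentiation of y^2 =
  P(w) gives 2 y y' = P'(w), which can be solved as y is nonzero.\<close>

lemma w_chart_derivs:
  assumes U: "coordinate_chart Sigma_curve U w_coord" "U \<subseteq> {Aff w y | w y. y \<noteq> 0}" "Aff w y \<in> U"
  shows "((\<lambda>z. w_coord (inv_into U w_coord z)) has_field_derivative 1) (at w)"
    and "((\<lambda>z. y_coord (inv_into U w_coord z)) has_field_derivative curve_poly' w / (2 * y)) (at w)"
proof -
  note c = coordinate_chart_affine_coords[OF U(1,3), simplified]
  have "y \<noteq> 0" using U by auto
  have W: "\<forall>\<^sub>F z in nhds w. z = w_coord (inv_into U w_coord z)"
    using c(5) by eventually_elim simp
  then show "((\<lambda>z. w_coord (inv_into U w_coord z)) has_field_derivative 1) (at w)"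
    using DERIV_cong_ev[OF refl W refl] DERIV_ident by blast
  show "((\<lambda>z. y_coord (inv_into U w_coord z)) has_field_derivative curve_poly' w / (2 * y)) (at w)"
  proof (rule has_field_derivative_implicit[OF _ _ curve_poly_deriv c(4)])
    show "\<forall>\<^sub>F z in nhds w. (y_coord (inv_into U w_coord z))\<^sup>2 = curve_poly z"
      using c(5) by eventually_elim simp
  qed (use square_deriv[of y] \<open>y \<noteq> 0\<close> c(2) in auto)
qed

lemma y_chart_derivs:
  assumes U: "coordinate_chart Sigma_curve U y_coord" "U \<subseteq> {Aff w y | w y. curve_poly' w \<noteq> 0}" "Aff w y \<in> U"
  shows "((\<lambda>z. w_coord (inv_into U y_coord z)) has_field_derivative 2 * y / curve_poly' w) (at y)"
    and "((\<lambda>z. y_coord (inv_into U y_coord z)) has_field_derivative 1) (at y)"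
proof -
  note c = coordinate_chart_affine_coords[OF U(1,3), simplified]
  have "curve_poly' w \<noteq> 0" using U by auto
  have Y: "\<forall>\<^sub>F z in nhds y. z = y_coord (inv_into U y_coord z)"
    using c(5) by eventually_elim simp
  then show "((\<lambda>z. y_coord (inv_into U y_coord z)) has_field_derivative 1) (at y)"
    using DERIV_cong_ev[OF refl Y refl] DERIV_ident by blast
  show "((\<lambda>z. w_coord (inv_into U y_coord z)) has_field_derivative 2 * y / curve_poly' w) (at y)"
  proof (rule has_field_derivative_implicit[OF _ _ square_deriv c(3)])
    show "\<forall>\<^sub>F z in nhds y. curve_poly (w_coord (inv_into U y_coord z)) = z\<^sup>2"
      using c(5) by eventually_elim metis
  qed (use curve_poly_deriv[of w] \<open>curve_poly' w \<noteq> 0\<close> c(1) in auto)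
qed

text \<open>Here w = 1/u, so dw = - w^2 du. The derivative of \<open>y\<close> again comes from y^2
  = P(w), with the right-hand side differentiated through \<open>w\<close>.\<close>

lemma u_chart_derivs:
  assumes U: "coordinate_chart Sigma_curve U u_coord"
    "U \<subseteq> {Aff w y | w y. w \<noteq> 0 \<and> y \<noteq> 0} \<union> range Infty" "Aff w y \<in> U"
  shows "((\<lambda>z. w_coord (inv_into U u_coord z)) has_field_derivative - w\<^sup>2) (at (1 / w))"
    and "((\<lambda>z. y_coord (inv_into U u_coord z)) has_field_derivative - w\<^sup>2 * curve_poly' w / (2 * y)) (at (1 / w))"
proof -
  note c = coordinate_chart_affine_coords[OF U(1,3), simplified]
  have nz: "w \<noteq> 0" "y \<noteq> 0" using U by auto
  have W: "\<forall>\<^sub>F z in nhds (1 / w). 1 / z = w_coord (inv_into U u_coord z)"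
    using c(5) by eventually_elim (metis div_by_1 divide_divide_eq_right mult_1 u_coord.simps(1))
  have "((\<lambda>z. 1 / z) has_field_derivative - w\<^sup>2) (at (1 / w))"
    using nz by (auto intro!: derivative_eq_intros simp: power2_eq_square)
  then show dW: "((\<lambda>z. w_coord (inv_into U u_coord z)) has_field_derivative - w\<^sup>2) (at (1 / w))"
    using DERIV_cong_ev[OF refl W refl] by blast
  have dP: "((\<lambda>z. curve_poly (w_coord (inv_into U u_coord z))) has_field_derivative curve_poly' w * - w\<^sup>2) (at (1 / w))"
    using DERIV_chain2[OF _ dW] curve_poly_deriv c(1) by metis
  have "((\<lambda>z. y_coord (inv_into U u_coord z)) has_field_derivative (curve_poly' w * - w\<^sup>2) / (2 * y)) (at (1 / w))"
  proof (rule has_field_derivative_implicit[OF _ _ dP c(4)])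
    show "\<forall>\<^sub>F z in nhds (1 / w). (y_coord (inv_into U u_coord z))\<^sup>2 = curve_poly (w_coord (inv_into U u_coord z))"
      using c(5) by eventually_elim simp
  qed (use square_deriv[of y] nz c(2) in auto)
  then show "((\<lambda>z. y_coord (inv_into U u_coord z)) has_field_derivative - w\<^sup>2 * curve_poly' w / (2 * y)) (at (1 / w))"
    by (simp add: mult.commute)
qed

definition quadratic :: "complex \<Rightarrow> complex \<Rightarrow> complex \<Rightarrow> complex \<Rightarrow> complex" where
  "quadratic a b c w = a + b * w + c * w\<^sup>2"

text \<open>The degree bound comes from infinity: w^k dw / y is regular there exactly for k at most
  two.\<close>

definition quadratic_form :: "complex \<Rightarrow> complex \<Rightarrow> complex \<Rightarrow> curve_point one_form" where
  "quadratic_form a b c = differential (\<lambda>q. quadratic a b c (w_coord q) / y_coord q) w_coord"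

lemma isCont_quadratic: "isCont (quadratic a b c) w"
  unfolding quadratic_def[abs_def] by (intro continuous_intros)

lemma isCont_curve_poly': "isCont curve_poly' w"
  unfolding curve_poly'_def[abs_def] by (intro continuous_intros)

text \<open>The coefficient is a limit over the punctured neighbourhood. At a zero of
  \<open>y\<close> or at infinity it is found by matching the raw expression with a continuous
  \<open>g\<close> away from the centre only.\<close>

lemma quadratic_form_eqI:
  assumes "isCont g z0" "g z0 = C"
    and "\<forall>\<^sub>F z in nhds z0. z \<noteq> z0 \<longrightarrow> quadratic a b c (w_coord (inv_into U \<phi> z)) / y_coord (inv_into U \<phi> z) *
      deriv (\<lambda>\<zeta>. w_coord (inv_into U \<phi> \<zeta>)) z = g z"
  shows "quadratic_form a b c (U, \<phi>) z0 = C"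
  unfolding quadratic_form_def differential_def case_prod_conv
proof (rule remove_sings_eqI)
  have "g \<midarrow>z0\<rightarrow> C" using assms(1,2) by (auto simp: isCont_def)
  then show "(\<lambda>z. quadratic a b c (w_coord (inv_into U \<phi> z)) / y_coord (inv_into U \<phi> z) *
      deriv (\<lambda>\<zeta>. w_coord (inv_into U \<phi> \<zeta>)) z) \<midarrow>z0\<rightarrow> C"
    by (rule Lim_transform_eventually)
       (use assms(3) in \<open>auto simp: eventually_at_filter elim!: eventually_mono\<close>)
qed

lemma quadratic_form_w_chart:
  assumes U: "coordinate_chart Sigma_curve U w_coord" "U \<subseteq> {Aff w y | w y. y \<noteq> 0}" "Aff w y \<in> U"
  shows "quadratic_form a b c (U, w_coord) w = quadratic a b c w / y"
proof -
  note c = coordinate_chart_affine_coords[OF U(1,3), simplified]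
  have "y \<noteq> 0" using U by auto
  let ?W = "\<lambda>z. w_coord (inv_into U w_coord z)" and ?Y = "\<lambda>z. y_coord (inv_into U w_coord z)"
  show ?thesis
  proof (rule quadratic_form_eqI)
    show "isCont (\<lambda>z. quadratic a b c (?W z) / ?Y z) w"
      using c(2) \<open>y \<noteq> 0\<close> by (intro continuous_divide isCont_o2[OF c(3) isCont_quadratic] c(4)) auto
    show "\<forall>\<^sub>F z in nhds w. z \<noteq> w \<longrightarrow> quadratic a b c (?W z) / ?Y z * deriv ?W z = quadratic a b c (?W z) / ?Y z"
      using c(5)
    proof eventually_elim
      case (elim z)
      then have "deriv ?W z = 1"
        using DERIV_imp_deriv[OF w_chart_derivs(1)[OF U(1,2)]] by fastforce
      then show ?case by simp
    qed
  qed (use c in auto)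
qed

lemma quadratic_form_y_chart:
  assumes U: "coordinate_chart Sigma_curve U y_coord" "U \<subseteq> {Aff w y | w y. curve_poly' w \<noteq> 0}" "Aff w y \<in> U"
  shows "quadratic_form a b c (U, y_coord) y = 2 * quadratic a b c w / curve_poly' w"
proof -
  note c = coordinate_chart_affine_coords[OF U(1,3), simplified]
  have nz: "curve_poly' w \<noteq> 0" using U by auto
  let ?W = "\<lambda>z. w_coord (inv_into U y_coord z)" and ?Y = "\<lambda>z. y_coord (inv_into U y_coord z)"
  \<comment> \<open>A factor \<open>z\<close>, which is the value of \<open>y\<close>, has to be
    cancelled. The centre may itself be a branch point, so nonvanishing is asked only away from
    it.\<close>
  have ne: "\<forall>\<^sub>F z in nhds y. z \<noteq> y \<longrightarrow> z \<noteq> 0"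
  proof (cases "y = 0")
    case False
    from t1_space_nhds[OF this] show ?thesis by (auto elim!: eventually_mono)
  qed auto
  show ?thesis
  proof (rule quadratic_form_eqI)
    show "isCont (\<lambda>z. 2 * quadratic a b c (?W z) / curve_poly' (?W z)) y"
      using c(1) nz
      by (intro continuous_divide continuous_mult continuous_const
          isCont_o2[OF c(3) isCont_quadratic] isCont_o2[OF c(3) isCont_curve_poly']) auto
    show "\<forall>\<^sub>F z in nhds y. z \<noteq> y \<longrightarrow> quadratic a b c (?W z) / ?Y z * deriv ?W z =
        2 * quadratic a b c (?W z) / curve_poly' (?W z)"
      using c(5) ne
    proof eventually_elim
      case (elim z)
      then have "deriv ?W z = 2 * z / curve_poly' (?W z)"
        using DERIV_imp_deriv[OF y_chart_derivs(1)[OF U(1,2)]] by fastforce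
      then show ?case using elim by auto
    qed
  qed (use c in auto)
qed

lemma quadratic_form_u_chart:
  assumes U: "coordinate_chart Sigma_curve U u_coord"
    "U \<subseteq> {Aff w y | w y. w \<noteq> 0 \<and> y \<noteq> 0} \<union> range Infty" "Aff w y \<in> U"
  shows "quadratic_form a b c (U, u_coord) (1 / w) = - w\<^sup>2 * quadratic a b c w / y"
proof -
  note c = coordinate_chart_affine_coords[OF U(1,3), simplified]
  have nz: "w \<noteq> 0" "y \<noteq> 0" using U by auto
  let ?W = "\<lambda>z. w_coord (inv_into U u_coord z)" and ?Y = "\<lambda>z. y_coord (inv_into U u_coord z)"
  show ?thesis
  proof (rule quadratic_form_eqI)
    show "isCont (\<lambda>z. - (?W z)\<^sup>2 * quadratic a b c (?W z) / ?Y z) (1 / w)"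
      using c(2) nz
      by (intro continuous_divide continuous_mult continuous_minus continuous_power c(3,4)
          isCont_o2[OF c(3) isCont_quadratic]) auto
    show "\<forall>\<^sub>F z in nhds (1 / w). z \<noteq> 1 / w \<longrightarrow> quadratic a b c (?W z) / ?Y z * deriv ?W z =
        - (?W z)\<^sup>2 * quadratic a b c (?W z) / ?Y z"
      using c(5)
    proof eventually_elim
      case (elim z)
      then have "deriv ?W z = - (?W z)\<^sup>2"
        using DERIV_imp_deriv[OF u_chart_derivs(1)[OF U(1,2)]] by fastforce
      then show ?case by simp
    qed
  qed (use c in auto)
qed

text \<open>With \<open>H\<close> the quadratic, \<open>P\<close> the curve polynomial and \<open>C\<close> the coefficient, the form satisfies
  \<open>C y dz = H dw\<close> and \<open>C P'(w) dz = 2 H dy\<close>; the second identity determines \<open>C\<close> where \<open>y = 0\<close>.\<close>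

lemma quadratic_form_affine:
  assumes "(U, \<phi>) \<in> Sigma_atlas" "Aff w y \<in> U"
  obtains W' Y' where
    "((\<lambda>z. w_coord (inv_into U \<phi> z)) has_field_derivative W') (at (\<phi> (Aff w y)))"
    "((\<lambda>z. y_coord (inv_into U \<phi> z)) has_field_derivative Y') (at (\<phi> (Aff w y)))"
    "\<And>a b c. quadratic_form a b c (U, \<phi>) (\<phi> (Aff w y)) * y = quadratic a b c w * W'"
    "\<And>a b c. quadratic_form a b c (U, \<phi>) (\<phi> (Aff w y)) * curve_poly' w = 2 * quadratic a b c w * Y'"
proof -
  note chart = Sigma_atlas_chart[OF assms(1)]
  show thesis
    using assms(1)
  proof (cases rule: Sigma_atlas_cases)
    case w
    note U = chart[unfolded w(1)] w(2) assms(2)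
    show thesis
      by (rule that) (use w_chart_derivs[OF U] quadratic_form_w_chart[OF U] w assms(2) in auto)
  next
    case y
    note U = chart[unfolded y(1)] y(2) assms(2)
    show thesis
      by (rule that) (use y_chart_derivs[OF U] quadratic_form_y_chart[OF U] y assms(2) in auto)
  next
    case u
    note U = chart[unfolded u(1)] u(2) assms(2)
    have "y \<noteq> 0" using U by auto
    then show thesis
      by (intro that[where W' = "- w\<^sup>2" and Y' = "- w\<^sup>2 * curve_poly' w / (2 * y)"]) (use u_chart_derivs[OF U] in \<open>simp_all add: u(1) quadratic_form_u_chart[OF U] divide_simps\<close>)
  qed
qed

text \<open>Substituting w = 1/u and y = v/u^4 turns the form into - (a u^2 + b u + c) du / v, so
  only \<open>c\<close> survives at u = 0.\<close>

lemma quadratic_form_infinity: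
  assumes A: "(U, \<phi>) \<in> Sigma_atlas" and v: "Infty v \<in> U"
  shows "\<phi> = u_coord"
    and "((\<lambda>z. u_coord (inv_into U \<phi> z)) has_field_derivative 1) (at (\<phi> (Infty v)))"
    and "quadratic_form a b c (U, \<phi>) (\<phi> (Infty v)) = - c / v"
proof -
  have u: "\<phi> = u_coord \<and> U \<subseteq> {Aff w y | w y. w \<noteq> 0 \<and> y \<noteq> 0} \<union> range Infty"
    using A by (cases rule: Sigma_atlas_cases) (use v in auto)
  then show "\<phi> = u_coord" by simp
  have U: "coordinate_chart Sigma_curve U u_coord" "U \<subseteq> {Aff w y | w y. w \<noteq> 0 \<and> y \<noteq> 0} \<union> range Infty"
    using Sigma_atlas_chart[OF A] u by auto
  let ?\<psi> = "inv_into U u_coord"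
  have ev: "\<forall>\<^sub>F z in nhds 0. ?\<psi> z \<in> U \<and> u_coord (?\<psi> z) = z"
    using coordinate_chart_eventually_inverse[OF U(1) v] by simp
  then have id: "\<forall>\<^sub>F z in nhds 0. z = u_coord (?\<psi> z)" by eventually_elim simp
  show "((\<lambda>z. u_coord (inv_into U \<phi> z)) has_field_derivative 1) (at (\<phi> (Infty v)))"
    using DERIV_cong_ev[OF refl id refl, THEN iffD1, OF DERIV_ident] u by simp
  \<comment> \<open>\<open>V\<close> is the coordinate \<open>v\<close> of the second affine piece
    along the chart. It takes the place of \<open>y_coord\<close>, which has a pole at infinity and
    a dummy value there.\<close>
  define V where "V z = snd (inv_into UNIV glue_inf (?\<psi> z))" for z
  have \<psi>0: "?\<psi> 0 = Infty v"
    using inv_into_f_f[OF coordinate_chart_inj[OF U(1)] v] by simp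
  have "?\<psi> 0 = glue_inf (0, v)" by (simp add: \<psi>0 glue_inf_def)
  then have V0: "V 0 = v"
    by (simp add: V_def inv_f_f[OF inj_glue_inf])
  have "v\<^sup>2 = 1"
    using v U(1) openin_subset[of Sigma_curve U] topspace_Sigma_curve
    by (intro Infty_in_curve_points) (auto simp: coordinate_chart_def)
  then have "v \<noteq> 0" by auto
  have z0: "0 \<in> u_coord ` U" using v by force
  note evg = eventually_in_glue_inf_image[OF coordinate_chart_inverse[OF U(1)]
      coordinate_chart_open_image[OF U(1)] z0 \<psi>0]
  have contV: "isCont V 0"
    unfolding isCont_def tendsto_def eventually_at_filter V0
  proof (intro allI impI)
    fix S :: "complex set" assume "open S" "v \<in> S"
    with evg[of "UNIV \<times> S"] show "\<forall>\<^sub>F z in nhds 0. z \<noteq> 0 \<longrightarrow> z \<in> UNIV \<longrightarrow> V z \<in> S"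
      by (auto simp: open_Times V_def inv_f_f[OF inj_glue_inf] elim!: eventually_mono)
  qed
  have evV: "\<forall>\<^sub>F z in nhds 0. ?\<psi> z = glue_inf (z, V z)"
    using evg[OF open_UNIV UNIV_I] id
  proof eventually_elim
    case (elim z)
    then obtain u' v' where *: "?\<psi> z = glue_inf (u', v')" by auto
    then have "u_coord (?\<psi> z) = u'" by (simp add: glue_inf_def)
    then show ?case using * elim by (simp add: V_def inv_f_f[OF inj_glue_inf])
  qed
  have "quadratic_form a b c (U, u_coord) 0 = - c / v"
  proof (rule quadratic_form_eqI)
    show "isCont (\<lambda>z. - (a * z\<^sup>2 + b * z + c) / V z) 0"
      using V0 \<open>v \<noteq> 0\<close> by (intro continuous_divide contV) (auto intro!: continuous_intros)
    show "\<forall>\<^sub>F z in nhds 0. z \<noteq> 0 \<longrightarrow> quadratic a b c (w_coord (?\<psi> z)) / y_coord (?\<psi> z) *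
      deriv (\<lambda>\<zeta>. w_coord (?\<psi> \<zeta>)) z = - (a * z\<^sup>2 + b * z + c) / V z"
      using evV ev
    proof eventually_elim
      case (elim z)
      show ?case
      proof
        assume z: "z \<noteq> 0"
        then have \<psi>: "?\<psi> z = Aff (1 / z) (V z / z ^ 4)"
          using elim by (simp add: glue_inf_def)
        have dW: "deriv (\<lambda>\<zeta>. w_coord (?\<psi> \<zeta>)) z = - (1 / z)\<^sup>2"
          using DERIV_imp_deriv[OF u_chart_derivs(1)[OF U, of "1 / z" "V z / z ^ 4"]] elim \<psi> by simp
        show "quadratic a b c (w_coord (?\<psi> z)) / y_coord (?\<psi> z) *
            deriv (\<lambda>\<zeta>. w_coord (?\<psi> \<zeta>)) z = - (a * z\<^sup>2 + b * z + c) / V z"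
        proof -
          have "quadratic a b c (1 / z) = (a * z\<^sup>2 + b * z + c) / z\<^sup>2"
            using z by (simp add: quadratic_def add_divide_distrib power2_eq_square)
          moreover have "N / z\<^sup>2 / (V z / z ^ 4) * - (1 / z)\<^sup>2 = - N / V z" for N
            using z by (simp add: power2_eq_square power4_eq_xxxx)
          ultimately show ?thesis
            by (simp only: dW \<psi> w_coord.simps y_coord.simps)
        qed
      qed
    qed
  qed (use V0 in auto)
  then show "quadratic_form a b c (U, \<phi>) (\<phi> (Infty v)) = - c / v"
    using u by simp
qed

section \<open>Local primitives\<close>

text \<open>A primitive found in one chart must have the right derivative in every chart of the
  atlas. The chain rule gives \<open>quadratic a b c w / y * W'\<close>, which the first relation of
  \<open>quadratic_form_affine\<close> identifies with the coefficient.\<close>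

lemma primitive_on_quadratic_form_w:
  assumes V: "openin Sigma_curve V" "V \<subseteq> {Aff w y | w y. y \<noteq> 0}"
    and G: "\<And>w y. Aff w y \<in> V \<Longrightarrow> (G has_field_derivative quadratic a b c w / y) (at w)"
  shows "primitive_on Sigma_curve Sigma_atlas (quadratic_form a b c) V (\<lambda>q. G (w_coord q))"
proof (rule primitive_onI[OF V(1)])
  fix U \<phi> q assume U: "(U, \<phi>) \<in> Sigma_atlas" "q \<in> U" and q: "q \<in> V"
  obtain w y where wy: "q = Aff w y" "y \<noteq> 0" using q V(2) by blast
  obtain W' where W': "((\<lambda>z. w_coord (inv_into U \<phi> z)) has_field_derivative W') (at (\<phi> (Aff w y)))"
      and C: "quadratic_form a b c (U, \<phi>) (\<phi> (Aff w y)) * y = quadratic a b c w * W'"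
    using quadratic_form_affine[OF U(1)] U(2) wy(1) by metis
  have W: "w_coord (inv_into U \<phi> (\<phi> (Aff w y))) = w"
    using coordinate_chart_affine_coords(1)[OF Sigma_atlas_chart[OF U(1)]] U(2) wy(1) by blast
  have "((\<lambda>z. G (w_coord (inv_into U \<phi> z))) has_field_derivative (quadratic a b c w / y * W')) (at (\<phi> (Aff w y)))"
    by (rule DERIV_chain2[OF _ W']) (use G q wy(1) W in simp)
  moreover have "quadratic a b c w / y * W' = quadratic_form a b c (U, \<phi>) (\<phi> (Aff w y))"
    using C wy(2) by (simp add: field_simps)
  ultimately show "((\<lambda>z. G (w_coord (inv_into U \<phi> z))) has_field_derivative quadratic_form a b c (U, \<phi>) (\<phi> q)) (at (\<phi> q))"
    using wy(1) by simp
qed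

text \<open>The second relation of \<open>quadratic_form_affine\<close> is used, because only that
  one determines the coefficient at branch points.\<close>

lemma primitive_on_quadratic_form_y:
  assumes V: "openin Sigma_curve V" "V \<subseteq> {Aff w y | w y. curve_poly' w \<noteq> 0}"
    and G: "\<And>w y. Aff w y \<in> V \<Longrightarrow> (G has_field_derivative 2 * quadratic a b c w / curve_poly' w) (at y)"
  shows "primitive_on Sigma_curve Sigma_atlas (quadratic_form a b c) V (\<lambda>q. G (y_coord q))"
proof (rule primitive_onI[OF V(1)])
  fix U \<phi> q assume U: "(U, \<phi>) \<in> Sigma_atlas" "q \<in> U" and q: "q \<in> V"
  obtain w y where wy: "q = Aff w y" "curve_poly' w \<noteq> 0" using q V(2) by blast
  obtain Y' where Y': "((\<lambda>z. y_coord (inv_into U \<phi> z)) has_field_derivative Y') (at (\<phi> (Aff w y)))"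
      and C: "quadratic_form a b c (U, \<phi>) (\<phi> (Aff w y)) * curve_poly' w = 2 * quadratic a b c w * Y'"
    using quadratic_form_affine[OF U(1)] U(2) wy(1) by metis
  have Y: "y_coord (inv_into U \<phi> (\<phi> (Aff w y))) = y"
    using coordinate_chart_affine_coords(2)[OF Sigma_atlas_chart[OF U(1)]] U(2) wy(1) by blast
  have "((\<lambda>z. G (y_coord (inv_into U \<phi> z))) has_field_derivative
      (2 * quadratic a b c w / curve_poly' w * Y')) (at (\<phi> (Aff w y)))"
    by (rule DERIV_chain2[OF _ Y']) (use G q wy(1) Y in simp)
  moreover have "2 * quadratic a b c w / curve_poly' w * Y' = quadratic_form a b c (U, \<phi>) (\<phi> (Aff w y))"
    using C wy(2) by (simp add: field_simps)
  ultimately show "((\<lambda>z. G (y_coord (inv_into U \<phi> z))) has_field_derivative quadratic_form a b c (U, \<phi>) (\<phi> q)) (at (\<phi> q))"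
    using wy(1) by simp
qed

text \<open>At affine points u = 1/w is differentiated through \<open>w\<close>; at infinity every
  available chart already has \<open>u_coord\<close> as its coordinate.\<close>

lemma primitive_on_quadratic_form_u:
  assumes V: "openin Sigma_curve V" "V \<subseteq> {Aff w y | w y. w \<noteq> 0 \<and> y \<noteq> 0} \<union> range Infty"
    and G: "\<And>w y. Aff w y \<in> V \<Longrightarrow> (G has_field_derivative - w\<^sup>2 * quadratic a b c w / y) (at (1 / w))"
      "\<And>v. Infty v \<in> V \<Longrightarrow> (G has_field_derivative - c / v) (at 0)"
  shows "primitive_on Sigma_curve Sigma_atlas (quadratic_form a b c) V (\<lambda>q. G (u_coord q))"
proof (rule primitive_onI[OF V(1)])
  fix U \<phi> q assume U: "(U, \<phi>) \<in> Sigma_atlas" "q \<in> U" and q: "q \<in> V"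
  note inj = coordinate_chart_inj[OF Sigma_atlas_chart[OF U(1)]]
  consider w y where "q = Aff w y" "w \<noteq> 0" "y \<noteq> 0" | v where "q = Infty v"
    using q V(2) by blast
  then show "((\<lambda>z. G (u_coord (inv_into U \<phi> z))) has_field_derivative quadratic_form a b c (U, \<phi>) (\<phi> q)) (at (\<phi> q))"
  proof cases
    case (1 w y)
    note c = coordinate_chart_affine_coords[OF Sigma_atlas_chart[OF U(1)] U(2)[unfolded 1(1)]]
    obtain W' where W': "((\<lambda>z. w_coord (inv_into U \<phi> z)) has_field_derivative W') (at (\<phi> (Aff w y)))"
        and C: "quadratic_form a b c (U, \<phi>) (\<phi> (Aff w y)) * y = quadratic a b c w * W'"
      using quadratic_form_affine[OF U(1)] U(2) 1(1) by metis
    have "((\<lambda>z. 1 / w_coord (inv_into U \<phi> z)) has_field_derivative - W' / w\<^sup>2) (at (\<phi> (Aff w y)))"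
      using DERIV_divide[OF DERIV_const[of 1] W'] c(1) 1(2) by (simp add: power2_eq_square)
    moreover have "\<forall>\<^sub>F z in nhds (\<phi> (Aff w y)). 1 / w_coord (inv_into U \<phi> z) = u_coord (inv_into U \<phi> z)"
      using eventually_in_glue_image[OF coordinate_chart_inverse[OF Sigma_atlas_chart[OF U(1)]]
          coordinate_chart_open_image[OF Sigma_atlas_chart[OF U(1)]] _
          inv_into_f_f[OF inj U(2)[unfolded 1(1)]] open_UNIV UNIV_I] U(2) 1(1)
      by (auto simp: glue_def elim!: eventually_mono)
    ultimately have u: "((\<lambda>z. u_coord (inv_into U \<phi> z)) has_field_derivative - W' / w\<^sup>2) (at (\<phi> (Aff w y)))"
      by (rule DERIV_cong_ev[OF refl _ refl, THEN iffD1, rotated])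
    have "u_coord (inv_into U \<phi> (\<phi> (Aff w y))) = 1 / w"
      using inv_into_f_f[OF inj U(2)] 1(1) by simp
    then have "((\<lambda>z. G (u_coord (inv_into U \<phi> z))) has_field_derivative
        (- w\<^sup>2 * quadratic a b c w / y * (- W' / w\<^sup>2))) (at (\<phi> (Aff w y)))"
      by (intro DERIV_chain2[OF _ u]) (use G(1) q 1(1) in simp)
    moreover have "- w\<^sup>2 * quadratic a b c w / y * (- W' / w\<^sup>2) = quadratic_form a b c (U, \<phi>) (\<phi> (Aff w y))"
      using C 1(2,3) by (simp add: field_simps)
    ultimately show ?thesis
      using 1(1) by simp
  next
    case (2 v)
    note inf = quadratic_form_infinity[OF U(1) U(2)[unfolded 2]]
    have "u_coord (inv_into U \<phi> (\<phi> (Infty v))) = 0"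
      using inv_into_f_f[OF inj U(2)] 2 by simp
    then have "((\<lambda>z. G (u_coord (inv_into U \<phi> z))) has_field_derivative (- c / v * 1)) (at (\<phi> (Infty v)))"
      by (intro DERIV_chain2[OF _ inf(2)]) (use G(2) q 2 in simp)
    then show ?thesis
      using 2 inf(3) by simp
  qed
qed

section \<open>Holomorphic branches, existence of charts and of local primitives\<close>

lemma local_sqrt_curve_poly:
  assumes "r0\<^sup>2 = curve_poly z0" "r0 \<noteq> 0"
  obtains e r where "e > 0" "r holomorphic_on ball z0 e" "r z0 = r0"
    "\<forall>z\<in>ball z0 e. (r z)\<^sup>2 = curve_poly z \<and> r z \<noteq> 0"
proof -
  have hol: "curve_poly holomorphic_on S" for S
    unfolding curve_poly_def[abs_def] by (intro holomorphic_intros)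
  have "open (curve_poly -` (- {0}))"
    using holomorphic_on_imp_continuous_on[OF hol[of UNIV]] by (intro continuous_open_vimage) (auto simp: continuous_on_eq_continuous_at)
  moreover have "z0 \<in> curve_poly -` (- {0})" using assms by auto
  ultimately obtain e where e: "e > 0" "ball z0 e \<subseteq> curve_poly -` (- {0})"
    using open_contains_ball by blast
  obtain g where g: "g holomorphic_on ball z0 e" "\<And>z. z \<in> ball z0 e \<Longrightarrow> curve_poly z = (g z)\<^sup>2"
    using contractible_imp_holomorphic_sqrt[OF hol convex_imp_contractible[OF convex_ball]] e(2) by blast
  have nz: "g z \<noteq> 0" if "z \<in> ball z0 e" for z
    using g(2)[OF that] e(2) that by auto
  \<comment> \<open>A square root on the disc is determined up to sign; the prescribed value at
    \<open>z0\<close> selects the sign.\<close>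
  have "(g z0)\<^sup>2 = r0\<^sup>2" using g(2)[of z0] e(1) assms(1) by simp
  then consider "g z0 = r0" | "g z0 = - r0" by (auto simp: power2_eq_iff)
  then show thesis
  proof cases
    case 1
    then show thesis using that[of e g] e g nz by auto
  next
    case 2
    then show thesis
      using that[of e "\<lambda>z. - g z"] e g nz by (auto intro!: holomorphic_intros)
  qed
qed

text \<open>Over \<open>B\<close> the curve consists of the sheets y = r(w) and y = - r(w). The open
  condition y + r(w) \<noteq> 0 keeps the first and drops the second.\<close>

lemma sqrt_graph:
  assumes B: "open B" "r holomorphic_on B" "\<forall>z\<in>B. (r z)\<^sup>2 = curve_poly z \<and> r z \<noteq> 0"
  defines "W \<equiv> {p. fst p \<in> B \<and> snd p + r (fst p) \<noteq> 0}"
  shows "open W" "(\<lambda>z. (z, r z)) ` B = W \<inter> affine_curve" "continuous_on B (\<lambda>z. (z, r z))"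
proof -
  have r: "continuous_on B r" using B(2) by (rule holomorphic_on_imp_continuous_on)
  have "continuous_on (B \<times> UNIV) (\<lambda>p. snd p + r (fst p))"
    by (intro continuous_intros continuous_on_compose2[OF r]) auto
  then have "open (B \<times> UNIV \<inter> (\<lambda>p. snd p + r (fst p)) -` (- {0}))"
    using B(1) by (intro continuous_open_preimage) (auto intro: open_Times)
  also have "B \<times> UNIV \<inter> (\<lambda>p. snd p + r (fst p)) -` (- {0}) = W"
    by (auto simp: W_def)
  finally show "open W" .
  show "(\<lambda>z. (z, r z)) ` B = W \<inter> affine_curve"
  proof (intro equalityI subsetI)
    fix p assume "p \<in> (\<lambda>z. (z, r z)) ` B"
    then show "p \<in> W \<inter> affine_curve"
      using B(3) by (auto simp: W_def in_affine_curve_iff simp flip: mult_2)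
  next
    fix p assume "p \<in> W \<inter> affine_curve"
    moreover obtain w y where p: "p = (w, y)" by (cases p)
    ultimately have w: "w \<in> B" "y + r w \<noteq> 0" "y\<^sup>2 = (r w)\<^sup>2"
      using B(3) by (auto simp: W_def in_affine_curve_iff)
    then have "y = r w" by (auto simp: power2_eq_iff)
    then show "p \<in> (\<lambda>z. (z, r z)) ` B" using w p by auto
  qed
  show "continuous_on B (\<lambda>z. (z, r z))" by (intro continuous_intros r)
qed

lemma holomorphic_ball_primitive:
  assumes "g holomorphic_on ball z0 e"
  obtains G where "\<And>z. z \<in> ball z0 e \<Longrightarrow> (G has_field_derivative g z) (at z)"
  using holomorphic_convex_primitive'[OF convex_ball open_ball assms] at_within_open[OF _ open_ball]
  by metis

lemma holomorphic_quadratic: "quadratic a b c holomorphic_on S"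
  unfolding quadratic_def[abs_def] by (intro holomorphic_intros)

text \<open>The branch of the square root with value \<open>y0\<close> parametrises a neighbourhood
  by a disc, and on a disc the holomorphic coefficient has a primitive.\<close>

lemma w_chart_exists:
  assumes "y0\<^sup>2 = curve_poly w0" "y0 \<noteq> 0"
  shows "\<exists>U G. Aff w0 y0 \<in> U \<and> (U, w_coord) \<in> Sigma_atlas \<and>
    primitive_on Sigma_curve Sigma_atlas (quadratic_form a b c) U G"
proof -
  obtain e r where e: "e > 0" and r: "r holomorphic_on ball w0 e" "r w0 = y0"
      "\<forall>z\<in>ball w0 e. (r z)\<^sup>2 = curve_poly z \<and> r z \<noteq> 0"
    using local_sqrt_curve_poly[OF assms] by blast
  define W where "W = {p. fst p \<in> ball w0 e \<and> snd p + r (fst p) \<noteq> 0}"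
  note graph = sqrt_graph[OF open_ball r(1,3), folded W_def]
  let ?U = "glue ` (W \<inter> affine_curve)"
  have U: "w \<in> ball w0 e \<and> y = r w" if "Aff w y \<in> ?U" for w y
    using that unfolding graph(2)[symmetric] by (auto simp: glue_def)
  have sub: "?U \<subseteq> {Aff w y | w y. y \<noteq> 0}"
    unfolding graph(2)[symmetric] using r(3) by (auto simp: glue_def)
  have chart: "coordinate_chart Sigma_curve ?U w_coord"
    by (rule coordinate_chart_graph[where pr = fst, OF continuous_map_glue inj_glue openin_glue_image
          _ _ open_ball graph(1,3) _ graph(2)]) (auto simp: glue_def intro!: continuous_intros)
  have "(\<lambda>z. quadratic a b c z / r z) holomorphic_on ball w0 e"
    using r by (intro holomorphic_intros holomorphic_quadratic) auto
  then obtain G where G: "\<And>z. z \<in> ball w0 e \<Longrightarrow> (G has_field_derivative quadratic a b c z / r z) (at z)"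
    by (rule holomorphic_ball_primitive) blast
  have "primitive_on Sigma_curve Sigma_atlas (quadratic_form a b c) ?U (\<lambda>q. G (w_coord q))"
  proof (rule primitive_on_quadratic_form_w[OF openin_glue_image[OF graph(1)] sub])
    fix w y assume "Aff w y \<in> ?U"
    then show "(G has_field_derivative quadratic a b c w / y) (at w)"
      using U[of w y] G[of w] by metis
  qed
  moreover have "(?U, w_coord) \<in> Sigma_atlas"
    unfolding Sigma_atlas_def using chart sub by blast
  moreover have "glue (w0, r w0) \<in> ?U"
    unfolding graph(2)[symmetric] using e by (intro imageI) simp
  then have "Aff w0 y0 \<in> ?U" using r(2) by (simp add: glue_def)
  ultimately show ?thesis by (intro exI conjI)
qed

lemma u_chart_exists:
  assumes "v0\<^sup>2 = 1"
  shows "\<exists>U G. Infty v0 \<in> U \<and> (U, u_coord) \<in> Sigma_atlas \<and>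
    primitive_on Sigma_curve Sigma_atlas (quadratic_form a b c) U G"
proof -
  have "v0\<^sup>2 = curve_poly 0" "v0 \<noteq> 0" using assms by (auto simp: curve_poly_def)
  then obtain e r where e: "e > 0" and r: "r holomorphic_on ball 0 e" "r 0 = v0"
      "\<forall>z\<in>ball 0 e. (r z)\<^sup>2 = curve_poly z \<and> r z \<noteq> 0"
    using local_sqrt_curve_poly by blast
  define W where "W = {p. fst p \<in> ball 0 e \<and> snd p + r (fst p) \<noteq> 0}"
  note graph = sqrt_graph[OF open_ball r(1,3), folded W_def]
  let ?U = "glue_inf ` (W \<inter> affine_curve)"
  have U: "w \<noteq> 0 \<and> 1 / w \<in> ball 0 e \<and> y = r (1 / w) * w ^ 4" if "Aff w y \<in> ?U" for w y
    using that unfolding graph(2)[symmetric] by (auto simp: glue_inf_def power_one_over split: if_splits)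
  have U': "v = r 0" if "Infty v \<in> ?U" for v
    using that unfolding graph(2)[symmetric] by (auto simp: glue_inf_def split: if_splits)
  have sub: "?U \<subseteq> {Aff w y | w y. w \<noteq> 0 \<and> y \<noteq> 0} \<union> range Infty"
    unfolding graph(2)[symmetric] using r(3) by (auto simp: glue_inf_def)
  have chart: "coordinate_chart Sigma_curve ?U u_coord"
    by (rule coordinate_chart_graph[where pr = fst, OF continuous_map_glue_inf inj_glue_inf openin_glue_inf_image
          _ _ open_ball graph(1,3) _ graph(2)]) (auto simp: glue_inf_def intro!: continuous_intros)
  have "(\<lambda>z. - (a * z\<^sup>2 + b * z + c) / r z) holomorphic_on ball 0 e"
    using r by (intro holomorphic_intros) auto
  then obtain G where G: "\<And>z. z \<in> ball 0 e \<Longrightarrow> (G has_field_derivative - (a * z\<^sup>2 + b * z + c) / r z) (at z)"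
    by (rule holomorphic_ball_primitive) blast
  have "primitive_on Sigma_curve Sigma_atlas (quadratic_form a b c) ?U (\<lambda>q. G (u_coord q))"
  proof (rule primitive_on_quadratic_form_u[OF openin_glue_inf_image[OF graph(1)] sub])
    fix w y assume "Aff w y \<in> ?U"
    from U[OF this] have w: "w \<noteq> 0" "1 / w \<in> ball 0 e" "y = r (1 / w) * w ^ 4" by auto
    \<comment> \<open>The coefficient in the coordinate u = 1/w, rewritten in affine terms;
      \<open>R\<close> will be the branch value, with y = R w^4.\<close>
    have "- (a * (1 / w)\<^sup>2 + b * (1 / w) + c) / R = - w\<^sup>2 * quadratic a b c w / (R * w ^ 4)" for R
    proof -
      have "a * (1 / w)\<^sup>2 + b * (1 / w) + c = quadratic a b c w / w\<^sup>2"
        using w(1) by (simp add: quadratic_def add_divide_distrib power2_eq_square)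
      moreover have "- (N / w\<^sup>2) / R = - w\<^sup>2 * N / (R * w ^ 4)" for N
        using w(1) by (simp add: power2_eq_square power4_eq_xxxx)
      ultimately show ?thesis by simp
    qed
    then show "(G has_field_derivative - w\<^sup>2 * quadratic a b c w / y) (at (1 / w))"
      using G[OF w(2)] w(3) by metis
  next
    fix v assume "Infty v \<in> ?U"
    then show "(G has_field_derivative - c / v) (at 0)"
      using U' G[of 0] e by simp
  qed
  moreover have "(?U, u_coord) \<in> Sigma_atlas"
    unfolding Sigma_atlas_def using chart sub by blast
  moreover have "glue_inf (0, r 0) \<in> ?U"
    unfolding graph(2)[symmetric] using e by (intro imageI) simp
  then have "Infty v0 \<in> ?U" using r(2) by (simp add: glue_inf_def)
  ultimately show ?thesis by (intro exI conjI)
qed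

text \<open>Near a simple root the polynomial has a holomorphic inverse \<open>h\<close>, so the
  curve is there the graph w = h(y^2).\<close>

lemma y_chart_exists:
  assumes "curve_poly w0 = 0"
  shows "\<exists>U G. Aff w0 0 \<in> U \<and> (U, y_coord) \<in> Sigma_atlas \<and>
    primitive_on Sigma_curve Sigma_atlas (quadratic_form a b c) U G"
proof -
  have hol: "curve_poly holomorphic_on S" for S
    unfolding curve_poly_def[abs_def] by (intro holomorphic_intros)
  have hol': "curve_poly' holomorphic_on S" for S
    unfolding curve_poly'_def[abs_def] by (intro holomorphic_intros)
  have deriv: "deriv curve_poly w = curve_poly' w" for w
    by (rule DERIV_imp_deriv[OF curve_poly_deriv])
  obtain d where d: "d > 0" "inj_on curve_poly (ball w0 d)"
    using has_complex_derivative_locally_injective[OF hol[of UNIV] UNIV_I open_UNIV, of w0]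
      curve_poly_simple_roots[OF assms] deriv by metis
  let ?N = "ball w0 d"
  obtain h where h: "h holomorphic_on (curve_poly ` ?N)"
      "\<And>z. z \<in> ?N \<Longrightarrow> deriv curve_poly z * deriv h (curve_poly z) = 1"
      "\<And>z. z \<in> ?N \<Longrightarrow> h (curve_poly z) = z"
    using holomorphic_has_inverse[OF hol open_ball d(2)] by blast
  have nz: "curve_poly' z \<noteq> 0" if "z \<in> ?N" for z
    using h(2)[OF that] deriv by auto
  have "open (curve_poly ` ?N)"
    by (rule open_mapping_thm3[OF hol open_ball d(2)])
  then have "open ((\<lambda>z. z\<^sup>2) -` (curve_poly ` ?N))"
    by (intro continuous_open_vimage) (auto intro!: continuous_intros)
  moreover have "0 \<in> (\<lambda>z. z\<^sup>2) -` (curve_poly ` ?N)"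
    using assms d(1) by (auto intro!: image_eqI[of _ _ w0])
  ultimately obtain e where e: "e > 0" "ball 0 e \<subseteq> (\<lambda>z. z\<^sup>2) -` (curve_poly ` ?N)"
    using open_contains_ball by blast
  define g where "g z = h (z\<^sup>2)" for z
  have g: "g z \<in> ?N \<and> curve_poly (g z) = z\<^sup>2" if "z \<in> ball 0 e" for z
  proof -
    obtain w where "w \<in> ?N" "z\<^sup>2 = curve_poly w" using e(2) \<open>z \<in> ball 0 e\<close> by blast
    then show ?thesis using h(3) by (simp add: g_def)
  qed
  have "h \<circ> (\<lambda>z. z\<^sup>2) holomorphic_on ball 0 e"
    by (rule holomorphic_on_compose_gen[OF _ h(1)]) (use e(2) in \<open>auto intro!: holomorphic_intros\<close>)
  then have holg: "g holomorphic_on ball 0 e"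
    unfolding g_def comp_def .
  \<comment> \<open>A product neighbourhood isolates the graph: the polynomial is injective on the
    first factor, so \<open>y\<close> determines \<open>w\<close>.\<close>
  define W where "W = ?N \<times> ball (0 :: complex) e"
  have W: "open W" by (simp add: W_def open_Times)
  have graph: "(\<lambda>z. (g z, z)) ` ball 0 e = W \<inter> affine_curve"
  proof (intro equalityI subsetI)
    fix p assume "p \<in> (\<lambda>z. (g z, z)) ` ball 0 e"
    then show "p \<in> W \<inter> affine_curve"
      using g by (auto simp: W_def in_affine_curve_iff)
  next
    fix p assume "p \<in> W \<inter> affine_curve"
    moreover obtain w y where p: "p = (w, y)" by (cases p)
    ultimately have w: "w \<in> ?N" "y \<in> ball 0 e" "y\<^sup>2 = curve_poly w"
      by (auto simp: W_def in_affine_curve_iff)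
    then have "g y = w" using h(3) by (simp add: g_def)
    then show "p \<in> (\<lambda>z. (g z, z)) ` ball 0 e" using w(2) p by auto
  qed
  let ?U = "glue ` (W \<inter> affine_curve)"
  have U: "y \<in> ball 0 e \<and> w = g y" if "Aff w y \<in> ?U" for w y
    using that unfolding graph[symmetric] by (auto simp: glue_def)
  have sub: "?U \<subseteq> {Aff w y | w y. curve_poly' w \<noteq> 0}"
    unfolding graph[symmetric] using nz g by (auto simp: glue_def)
  have cont: "continuous_on (ball 0 e) (\<lambda>z. (g z, z))"
    by (intro continuous_intros holomorphic_on_imp_continuous_on[OF holg])
  have chart: "coordinate_chart Sigma_curve ?U y_coord"
    by (rule coordinate_chart_graph[where pr = snd, OF continuous_map_glue inj_glue openin_glue_image
          _ _ open_ball W cont _ graph]) (auto simp: glue_def intro!: continuous_intros)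
  have "(\<lambda>z. 2 * quadratic a b c (g z) / curve_poly' (g z)) holomorphic_on ball 0 e"
    using nz g holomorphic_on_compose[OF holg holomorphic_quadratic, of a b c]
      holomorphic_on_compose[OF holg hol']
    by (intro holomorphic_intros) (auto simp: comp_def)
  then obtain G where G: "\<And>z. z \<in> ball 0 e \<Longrightarrow>
      (G has_field_derivative 2 * quadratic a b c (g z) / curve_poly' (g z)) (at z)"
    by (rule holomorphic_ball_primitive) blast
  have "primitive_on Sigma_curve Sigma_atlas (quadratic_form a b c) ?U (\<lambda>q. G (y_coord q))"
  proof (rule primitive_on_quadratic_form_y[OF openin_glue_image[OF W] sub])
    fix w y assume "Aff w y \<in> ?U"
    then show "(G has_field_derivative 2 * quadratic a b c w / curve_poly' w) (at y)"
      using U[of w y] G[of y] by metis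
  qed
  moreover have "(?U, y_coord) \<in> Sigma_atlas"
    unfolding Sigma_atlas_def using chart sub[unfolded curve_poly'_def] by blast
  moreover have "Aff w0 0 \<in> ?U"
  proof -
    have "g 0 = w0" using h(3)[of w0] assms d(1) by (simp add: g_def)
    moreover have "glue (g 0, 0) \<in> ?U"
      unfolding graph[symmetric] using e(1) by (intro imageI) simp
    ultimately show ?thesis by (simp add: glue_def)
  qed
  ultimately show ?thesis by (intro exI conjI)
qed

lemma atlas_chart_exists:
  assumes "q \<in> curve_points"
  shows "\<exists>U \<phi> G. q \<in> U \<and> (U, \<phi>) \<in> Sigma_atlas \<and>
    primitive_on Sigma_curve Sigma_atlas (quadratic_form a b c) U G"
proof (cases q)
  case (Aff w y)
  then have y: "y\<^sup>2 = curve_poly w" using assms Aff_in_curve_points_iff by simp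
  show ?thesis
  proof (cases "y = 0")
    case True
    then have "curve_poly w = 0" using y by simp
    from y_chart_exists[OF this, of a b c] show ?thesis unfolding Aff True by (elim exE) (intro exI)
  next
    case False
    from w_chart_exists[OF y this, of a b c] show ?thesis unfolding Aff by (elim exE) (intro exI)
  qed
next
  case (Infty v)
  have "v\<^sup>2 = 1" using assms Infty_in_curve_points unfolding Infty by simp
  from u_chart_exists[OF this, of a b c] show ?thesis unfolding Infty by (elim exE) (intro exI)
qed

lemma locally_exact_quadratic_form:
  "locally_exact_form Sigma_curve Sigma_atlas (quadratic_form a b c)"
proof
  show "coordinate_chart Sigma_curve U \<phi>" if "(U, \<phi>) \<in> Sigma_atlas" for U \<phi>
    using that by (rule Sigma_atlas_chart)
  fix p assume "p \<in> topspace Sigma_curve"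
  then have "p \<in> curve_points" by (simp add: topspace_Sigma_curve)
  from atlas_chart_exists[OF this, of a b c] obtain U \<phi> G where "p \<in> U" "(U, \<phi>) \<in> Sigma_atlas"
    "primitive_on Sigma_curve Sigma_atlas (quadratic_form a b c) U G"
    by (elim exE conjE)
  then show "\<exists>(U, \<phi>)\<in>Sigma_atlas. p \<in> U"
    and "\<exists>V F. p \<in> V \<and> primitive_on Sigma_curve Sigma_atlas (quadratic_form a b c) V F"
    by (blast, intro exI conjI)
qed

section \<open>The automorphism and the period map\<close>

text \<open>Pulling back a form by \<open>f\<close> compares the chart on \<open>U\<close> with one
  on its image, which must again be a chart for the same coordinate function. Since \<open>f\<close>
  multiplies that coordinate by \<open>\<kappa>\<close>, the new inverse divides by
  \<open>\<kappa>\<close>, applies the old inverse and then \<open>f\<close>.\<close>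

lemma coordinate_chart_image:
  assumes U: "coordinate_chart X U \<phi>"
    and f: "continuous_map X X f" and g: "continuous_map X X g"
    and inverse: "\<And>q. q \<in> topspace X \<Longrightarrow> g (f q) = q" "\<And>q. q \<in> topspace X \<Longrightarrow> f (g q) = q"
    and \<kappa>: "\<kappa> \<noteq> 0" "\<And>q. q \<in> U \<Longrightarrow> \<phi> (f q) = \<kappa> * \<phi> q"
  shows "coordinate_chart X (f ` U) \<phi>"
proof -
  have UX: "openin X U" using U by (simp add: coordinate_chart_def)
  then have sub: "U \<subseteq> topspace X" by (rule openin_subset)
  have fU: "f ` U = {q \<in> topspace X. g q \<in> U}"
  proof (intro equalityI subsetI)
    fix q assume "q \<in> f ` U"
    then show "q \<in> {q \<in> topspace X. g q \<in> U}"
      using sub inverse(1) continuous_map_image_subset_topspace[OF f] by force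
  next
    fix q assume q: "q \<in> {q \<in> topspace X. g q \<in> U}"
    then have "f (g q) \<in> f ` U" by blast
    then show "q \<in> f ` U" using q inverse(2) by simp
  qed
  have open_fU: "openin X (f ` U)"
    unfolding fU by (rule openin_continuous_map_preimage[OF g UX])
  let ?B = "(\<lambda>z. z / \<kappa>) -` (\<phi> ` U)"
  have B: "open ?B"
    by (intro continuous_open_vimage coordinate_chart_open_image[OF U])
       (use \<kappa> in \<open>auto intro!: continuous_intros\<close>)
  show ?thesis
  proof (rule coordinate_chartI[OF open_fU B, where k = "\<lambda>z. f (inv_into U \<phi> (z / \<kappa>))"])
    have gU: "continuous_map (subtopology X (f ` U)) (subtopology X U) g"
      unfolding continuous_map_in_subtopology using g fU by (auto intro: continuous_map_from_subtopology)
    from continuous_map_compose[OF gU coordinate_chart_continuous[OF U]]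
    have "continuous_map (subtopology X (f ` U)) euclidean (\<lambda>q. \<phi> (g q))"
      by (simp add: comp_def)
    then have "continuous_map (subtopology X (f ` U)) euclidean (\<lambda>q. \<kappa> * \<phi> (g q))"
      using continuous_map_compose[of _ _ "\<lambda>q. \<phi> (g q)" euclidean "\<lambda>z. \<kappa> * z"]
      by (simp add: comp_def continuous_on_mult_left)
    then show "continuous_map (subtopology X (f ` U)) euclidean \<phi>"
      by (rule continuous_map_eq) (use \<kappa> fU inverse in force)
    have "continuous_map (top_of_set ?B) (top_of_set (\<phi> ` U)) (\<lambda>z. z / \<kappa>)"
      using \<kappa> by (auto intro!: continuous_intros)
    from continuous_map_compose[OF continuous_map_compose[OF this coordinate_chart_inverse[OF U]] f]
    show "continuous_map (top_of_set ?B) X (\<lambda>z. f (inv_into U \<phi> (z / \<kappa>)))"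
      by (simp add: comp_def)
  next
    fix z assume "z \<in> ?B"
    then have "inv_into U \<phi> (z / \<kappa>) \<in> U" "\<phi> (inv_into U \<phi> (z / \<kappa>)) = z / \<kappa>"
      by (auto intro: inv_into_into f_inv_into_f)
    then show "f (inv_into U \<phi> (z / \<kappa>)) \<in> f ` U \<and> \<phi> (f (inv_into U \<phi> (z / \<kappa>))) = z"
      using \<kappa> by simp
  next
    fix q assume "q \<in> f ` U"
    then obtain p where p: "p \<in> U" "q = f p" by blast
    then show "\<phi> q \<in> ?B \<and> f (inv_into U \<phi> (\<phi> q / \<kappa>)) = q"
      using \<kappa> coordinate_chart_inj[OF U] by (simp add: inv_into_f_f)
  qed
qed

lemma i_times_i_times: "\<i> * (\<i> * z) = - z"
  unfolding mult.assoc[symmetric] by simp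

lemma sigma_coords:
  shows "w_coord (sigma q) = \<i> * w_coord q"
    and "y_coord (sigma q) = y_coord q"
    and "u_coord (sigma q) = - \<i> * u_coord q"
proof -
  have "1 / (\<i> * w) = - \<i> * (1 / w)" for w
    using divide_divide_eq_left[of 1 \<i> w] by simp
  then show "u_coord (sigma q) = - \<i> * u_coord q" by (cases q) simp_all
qed (cases q; simp)+

lemma sigma_4: "sigma (sigma (sigma (sigma q))) = q"
  by (cases q) (simp_all add: i_times_i_times)

text \<open>The left-hand coefficients are those of \<open>k\<close> times the pullback by
  \<open>sigma\<close>: the substitution of \<open>\<i> * w\<close> changes the quadratic, and dw
  contributes the further factor \<open>\<i>\<close>.\<close>

lemma quadratic_imaginary:
  "quadratic (k * \<i> * a) (- (k * b)) (- (k * \<i> * c)) w = k * \<i> * quadratic a b c (\<i> * w)"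
  by (simp add: quadratic_def power_mult_distrib distrib_left right_diff_distrib mult.left_commute i_times_i_times mult.assoc)

lemma curve_poly'_imaginary: "curve_poly' (\<i> * w) = - \<i> * curve_poly' w"
proof -
  have "\<i> ^ 7 = - \<i>" "\<i> ^ 3 = - \<i>"
    by (simp_all add: eval_nat_numeral i_times_i_times)
  then show ?thesis
    unfolding curve_poly'_def power_mult_distrib by (simp add: right_diff_distrib)
qed

text \<open>The functions \<open>w_coord\<close>, \<open>y_coord\<close> and \<open>u_coord\<close>
  are eigenfunctions of \<open>sigma\<close> with eigenvalues \<i>, 1 and -\<i>, and the conditions
  on the chart domains are invariant.\<close>

lemma Sigma_atlas_sigma:
  assumes A: "(U, \<phi>) \<in> Sigma_atlas"
  obtains \<kappa> where "\<kappa> \<noteq> 0" "(sigma ` U, \<phi>) \<in> Sigma_atlas" "\<And>q. \<phi> (sigma q) = \<kappa> * \<phi> q"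
proof -
  \<comment> \<open>The fourth power of \<open>sigma\<close> is the identity, so its cube is a
    continuous inverse.\<close>
  have "continuous_map Sigma_curve Sigma_curve (sigma \<circ> sigma \<circ> sigma)"
    by (intro continuous_map_compose[of _ Sigma_curve] continuous_map_sigma)
  note image = coordinate_chart_image[OF Sigma_atlas_chart[OF A] continuous_map_sigma this]
  show thesis
    using A
  proof (cases rule: Sigma_atlas_cases)
    case w
    have "coordinate_chart Sigma_curve (sigma ` U) w_coord"
      by (rule image[unfolded w(1), where \<kappa> = \<i>]) (simp_all add: sigma_4 sigma_coords)
    moreover have "sigma ` U \<subseteq> {Aff w y | w y. y \<noteq> 0}" using w(2) by auto
    ultimately have "(sigma ` U, w_coord) \<in> Sigma_atlas" unfolding Sigma_atlas_def by blast
    then show thesis using that[of \<i>] w(1) sigma_coords by simp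
  next
    case y
    have "coordinate_chart Sigma_curve (sigma ` U) y_coord"
      by (rule image[unfolded y(1), where \<kappa> = 1]) (simp_all add: sigma_4 sigma_coords)
    moreover have "sigma ` U \<subseteq> {Aff w y | w y. curve_poly' w \<noteq> 0}"
      using y(2) by (auto simp: curve_poly'_imaginary)
    ultimately have "(sigma ` U, y_coord) \<in> Sigma_atlas"
      unfolding Sigma_atlas_def curve_poly'_def by blast
    then show thesis using that[of 1] y(1) sigma_coords by simp
  next
    case u
    have "coordinate_chart Sigma_curve (sigma ` U) u_coord"
      by (rule image[unfolded u(1), where \<kappa> = "- \<i>"]) (simp_all add: sigma_4 sigma_coords)
    moreover have "sigma ` U \<subseteq> {Aff w y | w y. w \<noteq> 0 \<and> y \<noteq> 0} \<union> range Infty"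
    proof
      fix p assume "p \<in> sigma ` U"
      then obtain q where "q \<in> U" "p = sigma q" by blast
      then show "p \<in> {Aff w y | w y. w \<noteq> 0 \<and> y \<noteq> 0} \<union> range Infty"
        using u(2) by (cases q) auto
    qed
    ultimately have "(sigma ` U, u_coord) \<in> Sigma_atlas" unfolding Sigma_atlas_def by blast
    then show thesis using that[of "- \<i>"] u(1) sigma_coords by simp
  qed
qed

text \<open>By the chain rule the claim reduces to \<open>k * (?C * \<kappa>) = ?C'\<close>, where
  \<open>?C\<close> is the coefficient at \<open>sigma q\<close>. At affine points nothing is
  computed chart by chart: the relations of \<open>quadratic_form_affine\<close> at \<open>q\<close>
  and at \<open>sigma q\<close> reduce it to comparing derivatives of \<open>w\<close> and
  \<open>y\<close>.\<close>

lemma primitive_on_sigma: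
  assumes F: "primitive_on Sigma_curve Sigma_atlas (quadratic_form a b c) V F"
  shows "primitive_on Sigma_curve Sigma_atlas (quadratic_form (k * \<i> * a) (- (k * b)) (- (k * \<i> * c)))
    {q \<in> topspace Sigma_curve. sigma q \<in> V} (\<lambda>q. k * F (sigma q))"
proof (rule primitive_onI)
  show "openin Sigma_curve {q \<in> topspace Sigma_curve. sigma q \<in> V}"
    by (rule openin_continuous_map_preimage[OF continuous_map_sigma primitive_on_openin[OF F]])
  fix U \<phi> q
  assume A: "(U, \<phi>) \<in> Sigma_atlas" "q \<in> U" and "q \<in> {q \<in> topspace Sigma_curve. sigma q \<in> V}"
  then have q: "sigma q \<in> V" by simp
  obtain \<kappa> where \<kappa>: "\<kappa> \<noteq> 0" "(sigma ` U, \<phi>) \<in> Sigma_atlas" "\<And>q. \<phi> (sigma q) = \<kappa> * \<phi> q"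
    using Sigma_atlas_sigma[OF A(1)] by metis
  let ?\<psi> = "inv_into U \<phi>" and ?\<psi>' = "inv_into (sigma ` U) \<phi>"
  let ?C = "quadratic_form a b c (sigma ` U, \<phi>) (\<phi> (sigma q))"
  let ?C' = "quadratic_form (k * \<i> * a) (- (k * b)) (- (k * \<i> * c)) (U, \<phi>) (\<phi> q)"
  have \<sigma>q: "sigma q \<in> sigma ` U" using A(2) by blast
  \<comment> \<open>In coordinates \<open>sigma\<close> is multiplication by
    \<open>\<kappa>\<close>, which relates the two inverse charts.\<close>
  have ev: "\<forall>\<^sub>F z in nhds (\<phi> q). ?\<psi>' (\<kappa> * z) = sigma (?\<psi> z)"
    using coordinate_chart_eventually_inverse[OF Sigma_atlas_chart[OF A(1)] A(2)]
  proof eventually_elim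
    case (elim z)
    then have "?\<psi>' (\<phi> (sigma (?\<psi> z))) = sigma (?\<psi> z)"
      by (intro inv_into_f_f coordinate_chart_inj[OF Sigma_atlas_chart[OF \<kappa>(2)]]) blast
    then show ?case using elim \<kappa>(3) by simp
  qed
  have pull: "((\<lambda>z. g (sigma (?\<psi> z))) has_field_derivative D * \<kappa>) (at (\<phi> q))"
    if "((\<lambda>z. g (?\<psi>' z)) has_field_derivative D) (at (\<phi> (sigma q)))" for g D
  proof -
    have "((\<lambda>z. g (?\<psi>' (\<kappa> * z))) has_field_derivative D * \<kappa>) (at (\<phi> q))"
      by (rule DERIV_chain2[where f = "\<lambda>z. g (?\<psi>' z)"])
         (use that \<kappa>(3) in \<open>auto intro!: derivative_eq_intros\<close>)
    moreover have "\<forall>\<^sub>F z in nhds (\<phi> q). g (?\<psi>' (\<kappa> * z)) = g (sigma (?\<psi> z))"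
      using ev by eventually_elim simp
    ultimately show ?thesis
      by (rule DERIV_cong_ev[OF refl _ refl, THEN iffD1, rotated])
  qed
  have "k * (?C * \<kappa>) = ?C'"
  proof (cases q)
    case (Aff w y)
    obtain W1 Y1 where 1: "((\<lambda>z. w_coord (?\<psi>' z)) has_field_derivative W1) (at (\<phi> (sigma q)))"
        "((\<lambda>z. y_coord (?\<psi>' z)) has_field_derivative Y1) (at (\<phi> (sigma q)))"
        "?C * y = quadratic a b c (\<i> * w) * W1"
        "?C * curve_poly' (\<i> * w) = 2 * quadratic a b c (\<i> * w) * Y1"
      using quadratic_form_affine[OF \<kappa>(2), of "\<i> * w" y] \<sigma>q unfolding Aff sigma.simps by metis
    obtain W2 Y2 where 2: "((\<lambda>z. w_coord (?\<psi> z)) has_field_derivative W2) (at (\<phi> q))"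
        "((\<lambda>z. y_coord (?\<psi> z)) has_field_derivative Y2) (at (\<phi> q))"
        "?C' * y = k * \<i> * quadratic a b c (\<i> * w) * W2"
        "?C' * curve_poly' w = 2 * (k * \<i> * quadratic a b c (\<i> * w)) * Y2"
      using quadratic_form_affine[OF A(1), of w y] A(2) unfolding Aff quadratic_imaginary[symmetric] by metis
    have W: "W1 * \<kappa> = \<i> * W2"
      using DERIV_unique[OF pull[OF 1(1), unfolded sigma_coords] DERIV_cmult[OF 2(1), of \<i>]] .
    have Y: "Y1 * \<kappa> = Y2"
      using DERIV_unique[OF pull[OF 1(2), unfolded sigma_coords] 2(2)] .
    \<comment> \<open>The relation through \<open>w\<close> can be cancelled when y is nonzero. At a
      branch point the relation through \<open>y\<close> takes over, since simplicity of the root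
      makes \<open>curve_poly' w\<close> nonzero.\<close>
    show ?thesis
    proof (cases "y = 0")
      case False
      have "k * (?C * \<kappa>) * y = k * ((?C * y) * \<kappa>)" by (simp only: ac_simps)
      also have "\<dots> = k * (quadratic a b c (\<i> * w) * (W1 * \<kappa>))" unfolding 1(3) by (simp only: ac_simps)
      also have "\<dots> = ?C' * y" unfolding 2(3) W by (simp only: ac_simps)
      finally show ?thesis using False by simp
    next
      case True
      have "Aff w y \<in> curve_points"
        using A Aff openin_subset[of Sigma_curve U] Sigma_atlas_chart[OF A(1)]
        by (auto simp: coordinate_chart_def topspace_Sigma_curve)
      then have nz: "curve_poly' w \<noteq> 0"
        using True by (intro curve_poly_simple_roots) (simp add: Aff_in_curve_points_iff)
      have "k * (?C * \<kappa>) * curve_poly' w = \<i> * (k * ((?C * curve_poly' (\<i> * w)) * \<kappa>))"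
        unfolding curve_poly'_imaginary by (simp add: mult.left_commute mult.assoc i_times_i_times)
      also have "\<dots> = \<i> * k * 2 * quadratic a b c (\<i> * w) * (Y1 * \<kappa>)" unfolding 1(4) by (simp only: ac_simps)
      also have "\<dots> = ?C' * curve_poly' w" unfolding 2(4) Y by (simp only: ac_simps)
      finally show ?thesis using nz by simp
    qed
  next
    case (Infty v)
    note 1 = quadratic_form_infinity[OF \<kappa>(2), of v] and 2 = quadratic_form_infinity[OF A(1), of v]
    have v: "Infty v \<in> U" "Infty v \<in> sigma ` U" using A(2) \<sigma>q unfolding Infty by simp_all
    have "((\<lambda>z. u_coord (?\<psi>' z)) has_field_derivative 1) (at (\<phi> (sigma q)))"
      using 1(2)[OF v(2)] unfolding Infty by simp
    from pull[OF this] have "((\<lambda>z. - \<i> * u_coord (?\<psi> z)) has_field_derivative 1 * \<kappa>) (at (\<phi> q))"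
      unfolding sigma_coords .
    moreover have "((\<lambda>z. - \<i> * u_coord (?\<psi> z)) has_field_derivative - \<i> * 1) (at (\<phi> q))"
      using DERIV_cmult[OF 2(2)[OF v(1)]] unfolding Infty .
    \<comment> \<open>The scaling factor of the chart, arbitrary so far, is pinned down by
      uniqueness of the derivative of \<open>u_coord\<close>; then the coefficients at infinity
      match.\<close>
    ultimately have "\<kappa> = - \<i>" using DERIV_unique by fastforce
    then show ?thesis
      unfolding Infty sigma.simps 1(3)[OF v(2)] 2(3)[OF v(1)] by simp
  qed
  then show "((\<lambda>z. k * F (sigma (?\<psi> z))) has_field_derivative ?C') (at (\<phi> q))"
    using DERIV_cmult[OF pull[OF primitive_on_deriv[OF F \<kappa>(2) \<sigma>q q]], of k] by simp
qed

section \<open>Equivariance and additivity of the period map\<close>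

lemma homology_integral_sigma:
  assumes "C \<in> carrier H1"
  shows "homology_integral Sigma_curve Sigma_atlas (quadratic_form (k * \<i> * a) (- (k * b)) (- (k * \<i> * c))) C =
    k * homology_integral Sigma_curve Sigma_atlas (quadratic_form a b c) (sigma_star C)"
  unfolding sigma_star_def
  by (rule homology_integral_hom_induced[OF locally_exact_quadratic_form locally_exact_quadratic_form
        continuous_map_sigma primitive_on_sigma assms])

text \<open>One constant \<open>\<kappa>\<close> covers both seeds, 2 and the unit complex numbers.
  The integrands agree as total functions, also where \<open>y_coord\<close> vanishes, because
  division by 0 gives 0.\<close>

lemma Phi_eq_quadratic_form:
  fixes \<kappa> lam :: complex
  defines "f \<equiv> \<lambda>q. \<kappa> / y_coord q"
  shows "Phi1 lam f = quadratic_form (\<kappa> / 2) 0 (- (\<kappa> / 2 * (1 + lam\<^sup>2)))"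
    and "Phi2 lam f = quadratic_form (\<i> * \<kappa> / 2) 0 (\<i> * \<kappa> / 2 * (1 + lam\<^sup>2))"
    and "Phi3 lam f = quadratic_form 0 \<kappa> 0"
    and "Phi4 lam f = quadratic_form 0 (lam * \<kappa>) 0"
  unfolding Phi1_def Phi2_def Phi3_def Phi4_def quadratic_form_def f_def quadratic_def
  by (rule arg_cong[where f = "\<lambda>h. differential h w_coord"], rule ext,
      simp add: algebra_simps divide_simps)+

text \<open>The pullback by \<open>sigma\<close> takes \<open>Phi1\<close> to \<open>Phi2\<close>,
  \<open>Phi2\<close> to minus \<open>Phi1\<close>, and \<open>Phi3\<close>, \<open>Phi4\<close> to
  their negatives. The factor \<open>k\<close> is 1 or -1 so that the form integrated over
  \<open>C\<close> is itself one of the four.\<close>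

lemma period_map_sigma_star:
  assumes C: "C \<in> carrier H1"
  shows "period_map lam (\<lambda>q. \<kappa> / y_coord q) (sigma_star C) = R_map (period_map lam (\<lambda>q. \<kappa> / y_coord q) C)"
proof -
  let ?f = "\<lambda>q. \<kappa> / y_coord q"
  let ?I = "\<lambda>a b c. homology_integral Sigma_curve Sigma_atlas (quadratic_form a b c)"
  note s = homology_integral_sigma[OF C]
  have "homology_integral Sigma_curve Sigma_atlas (Phi1 lam ?f) (sigma_star C) =
      homology_integral Sigma_curve Sigma_atlas (Phi2 lam ?f) C"
    using s[of 1 "\<kappa> / 2" 0 "- (\<kappa> / 2 * (1 + lam\<^sup>2))"] by (simp add: Phi_eq_quadratic_form mult.assoc)
  moreover have "homology_integral Sigma_curve Sigma_atlas (Phi2 lam ?f) (sigma_star C) =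
      - homology_integral Sigma_curve Sigma_atlas (Phi1 lam ?f) C"
    using s[of "- 1" "\<i> * \<kappa> / 2" 0 "\<i> * \<kappa> / 2 * (1 + lam\<^sup>2)"]
    by (simp add: Phi_eq_quadratic_form flip: mult.assoc)
  moreover have "homology_integral Sigma_curve Sigma_atlas (Phi3 lam ?f) (sigma_star C) =
      - homology_integral Sigma_curve Sigma_atlas (Phi3 lam ?f) C"
    using s[of "- 1" 0 \<kappa> 0] by (simp add: Phi_eq_quadratic_form)
  moreover have "homology_integral Sigma_curve Sigma_atlas (Phi4 lam ?f) (sigma_star C) =
      - homology_integral Sigma_curve Sigma_atlas (Phi4 lam ?f) C"
    using s[of "- 1" 0 "lam * \<kappa>" 0] by (simp add: Phi_eq_quadratic_form)
  ultimately show ?thesis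
    by (simp add: period_map_def R_map_def)
qed

lemma period_map_mult:
  assumes "C \<in> carrier H1" "D \<in> carrier H1"
  shows "period_map lam (\<lambda>q. \<kappa> / y_coord q) (C \<otimes>\<^bsub>H1\<^esub> D) =
    period_map lam (\<lambda>q. \<kappa> / y_coord q) C + period_map lam (\<lambda>q. \<kappa> / y_coord q) D"
  unfolding period_map_def Phi_eq_quadratic_form
    locally_exact_form.homology_integral_mult[OF locally_exact_quadratic_form assms]
  by (simp add: vec_eq_iff forall_4)

section \<open>Lattice arithmetic and propagation along orbits\<close>

lemma inj_R_map: "inj R_map"
  by (rule injI) (simp add: R_map_def vec_eq_iff forall_4)

lemma rank4_lattice_add:
  assumes "rank4_lattice L" "x \<in> L" "y \<in> L"
  shows "x + y \<in> L"
proof -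
  obtain B where B: "L = {\<Sum>b\<in>B. of_int (n b) *\<^sub>R b | n :: real ^ 4 \<Rightarrow> int. True}"
    using assms(1) unfolding rank4_lattice_def by blast
  obtain m n where "x = (\<Sum>b\<in>B. of_int (m b) *\<^sub>R b)" "y = (\<Sum>b\<in>B. of_int (n b) *\<^sub>R b)"
    using assms(2,3) unfolding B by blast
  then have "x + y = (\<Sum>b\<in>B. of_int (m b + n b) *\<^sub>R b)"
    by (simp add: sum.distrib scaleR_add_left)
  then show ?thesis unfolding B by (auto intro: exI[of _ "\<lambda>b. m b + n b"])
qed

lemma rank4_lattice_minus:
  assumes "rank4_lattice L" "x \<in> L"
  shows "- x \<in> L"
proof -
  obtain B where B: "L = {\<Sum>b\<in>B. of_int (n b) *\<^sub>R b | n :: real ^ 4 \<Rightarrow> int. True}"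
    using assms(1) unfolding rank4_lattice_def by blast
  obtain n where "x = (\<Sum>b\<in>B. of_int (n b) *\<^sub>R b)"
    using assms(2) unfolding B by blast
  then have "- x = (\<Sum>b\<in>B. of_int (- n b) *\<^sub>R b)"
    by (simp add: sum_negf)
  then show ?thesis unfolding B by (auto intro: exI[of _ "\<lambda>b. - n b"])
qed

lemma rank4_lattice_zero: "rank4_lattice L \<Longrightarrow> 0 \<in> L"
  unfolding rank4_lattice_def by (auto intro!: exI[of _ "\<lambda>_. 0"])

theorem corollary10p3:
  fixes lam :: complex
    and f :: "curve_point \<Rightarrow> complex"
    and \<Lambda> :: "(real ^ 4) set"
    and \<Gamma> S :: "curve_point chain set set"
  assumes f: "f = (\<lambda>q. 2 / y_coord q) \<or>
      (\<exists>\<theta>\<in>{0..pi / 2}. f = (\<lambda>q. exp (\<i> * complex_of_real \<theta>) / y_coord q))"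
    and lattice: "rank4_lattice \<Lambda>"
    and R_invariant: "R_map ` \<Lambda> = \<Lambda>"
    and \<Gamma>_subset: "\<Gamma> \<subseteq> carrier H1"
    and \<Gamma>_generates: "generate H1 \<Gamma> = carrier H1"
    and \<Gamma>_stable: "sigma_star ` \<Gamma> \<subseteq> \<Gamma>"
    and S_subset: "S \<subseteq> \<Gamma>"
    and S_representatives: "\<forall>\<gamma>\<in>\<Gamma>. \<exists>!s. s \<in> S \<inter> orbit sigma_star \<gamma>"
  shows "period_map lam f ` carrier H1 \<subseteq> \<Lambda> \<longleftrightarrow> (\<forall>\<gamma>\<in>S. period_map lam f \<gamma> \<in> \<Lambda>)"
proof
  assume "period_map lam f ` carrier H1 \<subseteq> \<Lambda>"
  then show "\<forall>\<gamma>\<in>S. period_map lam f \<gamma> \<in> \<Lambda>"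
    using S_subset \<Gamma>_subset by blast
next
  assume S: "\<forall>\<gamma>\<in>S. period_map lam f \<gamma> \<in> \<Lambda>"
  obtain \<kappa> where \<kappa>: "f = (\<lambda>q. \<kappa> / y_coord q)" using f by blast
  let ?P = "period_map lam f"
  \<comment> \<open>\<open>orbit\<close> collects forward iterates, so a representative lies ahead
    of \<open>\<gamma>\<close> and its period is a power of \<open>R_map\<close> applied to that of
    \<open>\<gamma>\<close>. Membership must therefore be carried backwards, which uses that
    \<open>\<Lambda>\<close> is contained in its image under the injective
    \<open>R_map\<close>.\<close>
  have R: "x \<in> \<Lambda>" if "R_map x \<in> \<Lambda>" for x
    using that R_invariant inj_R_map by (metis inj_image_mem_iff)
  \<comment> \<open>Membership in \<open>\<Gamma>\<close> is carried through the induction because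
    equivariance is available only for classes in the carrier of \<open>H1\<close>.\<close>
  have orbit: "s \<in> \<Gamma> \<and> (?P s \<in> \<Lambda> \<longrightarrow> ?P \<gamma> \<in> \<Lambda>)" if "\<gamma> \<in> \<Gamma>" "s \<in> orbit sigma_star \<gamma>" for \<gamma> s
    using that(2)
  proof induction
    case base
    have "?P (sigma_star \<gamma>) = R_map (?P \<gamma>)"
      unfolding \<kappa> using that(1) \<Gamma>_subset by (intro period_map_sigma_star) blast
    then show ?case using R that(1) \<Gamma>_stable by auto
  next
    case (step t)
    then have "?P (sigma_star t) = R_map (?P t)"
      unfolding \<kappa> using \<Gamma>_subset by (intro period_map_sigma_star) blast
    then show ?case using R step \<Gamma>_stable by auto
  qed
  have \<Gamma>: "?P \<gamma> \<in> \<Lambda>" if "\<gamma> \<in> \<Gamma>" for \<gamma>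
    using S S_representatives orbit that by blast
  interpret H1: group H1 by simp
  have mult: "?P (C \<otimes>\<^bsub>H1\<^esub> D) = ?P C + ?P D" if "C \<in> carrier H1" "D \<in> carrier H1" for C D
    unfolding \<kappa> using that by (rule period_map_mult)
  \<comment> \<open>Additivity alone forces the values at the neutral element and at inverses, as
    the target is a group.\<close>
  have one: "?P \<one>\<^bsub>H1\<^esub> = 0"
    using mult[of "\<one>\<^bsub>H1\<^esub>" "\<one>\<^bsub>H1\<^esub>"] by simp
  have inv: "?P (inv\<^bsub>H1\<^esub> C) = - ?P C" if "C \<in> carrier H1" for C
    using mult[of C "inv\<^bsub>H1\<^esub> C"] that one by (simp add: eq_neg_iff_add_eq_0 add.commute)
  have "?P C \<in> \<Lambda>" if "C \<in> generate H1 \<Gamma>" for C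
    using that
  proof induction
    case one
    then show ?case using \<open>?P \<one>\<^bsub>H1\<^esub> = 0\<close> rank4_lattice_zero[OF lattice] by simp
  next
    case (incl h)
    then show ?case by (rule \<Gamma>)
  next
    case (inv h)
    then have "?P (inv\<^bsub>H1\<^esub> h) = - ?P h" using \<open>\<And>C. C \<in> carrier H1 \<Longrightarrow> ?P (inv\<^bsub>H1\<^esub> C) = - ?P C\<close> \<Gamma>_subset by blast
    then show ?case using \<Gamma>[OF inv] rank4_lattice_minus[OF lattice] by simp
  next
    case (eng h1 h2)
    then have "?P (h1 \<otimes>\<^bsub>H1\<^esub> h2) = ?P h1 + ?P h2" using mult \<Gamma>_generates by blast
    then show ?case using eng rank4_lattice_add[OF lattice] by simp
  qed
  then show "?P ` carrier H1 \<subseteq> \<Lambda>" using \<Gamma>_generates by blast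
qed

end
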